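(* Let $\widetilde{H}$ be the affine Hecke algebra of type $G_2$. Let $t=t_{q^2,1}$ and $w_0=s_1s_2s_1s_2s_1s_2$. Let $\mathbb{C}v_t$ and $\mathbb{C}v_{w_0t}$ be the $1$-dimensional $\widetilde{H}_{\{1\}}$-modules given by $T_1v_t=qv_t$, $X^\lambda v_t=t(X^\lambda)v_t$, and $T_1v_{w_0t}=-q^{-1}v_{w_0t}$, $X^\lambda v_{w_0t}=(w_0t)(X^\lambda)v_{w_0t}$, and let $M=\widetilde{H}\otimes_{\widetilde{H}_{\{1\}}}\mathbb{C}v_t$ and $N=\widetilde{H}\otimes_{\widetilde{H}_{\{1\}}}\mathbb{C}v_{w_0t}$. If $q^2$ is a primitive third root of unity, then $M$ and $N$ are irreducible.
   Context: The type $G_2$ root system has simple roots $\alpha_1,\alpha_2$ with $\langle\alpha_1,\alpha_2^\vee\rangle=-1$, $\langle\alpha_2,\alpha_1^\vee\rangle=-3$; $s_i\lambda=\lambda-\langle\lambda,\alpha_i^\vee\rangle\alpha_i$, and $W_0=\langle s_1,s_2\rangle$. $P=\mathbb{Z}\alpha_1+\mathbb{Z}\alpha_2$ is the weight lattice; $X=\{X^\lambda\mid\lambda\in P\}$, $X^\lambda X^\mu=X^{\lambda+\mu}$. For $q\in\mathbb{C}^\times$, $\widetilde{H}$ is the $\mathbb{C}$-algebra generated by $T_1,T_2$ and $X^\lambda$ ($\lambda\in P$), with the group algebra $\mathbb{C}[X]$ a subalgebra, subject to $T_i^2=(q-q^{-1})T_i+1$, $T_1T_2T_1T_2T_1T_2=T_2T_1T_2T_1T_2T_1$,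 and $X^\lambda T_i=T_iX^{s_i\lambda}+(q-q^{-1})\frac{X^\lambda-X^{s_i\lambda}}{1-X^{-\alpha_i}}$. $\widetilde{H}_{\{i\}}$ is the subalgebra generated by $T_i$ and $\mathbb{C}[X]$. Weights are elements of $T=\mathrm{Hom}(X,\mathbb{C}^\times)$, with $W_0$-action $(wt)(X^\lambda)=t(X^{w^{-1}\lambda})$; $t_{z,w}\in T$ is given by $t_{z,w}(X^{\alpha_1})=z$, $t_{z,w}(X^{\alpha_2})=w$. *)

theory Defs
  imports Complex_Main "HOL-Algebra.Algebra" "HOL-Library.Poly_Mapping" "HOL-Library.Product_Plus"
begin

section \<open>The root system of type G2\<close>

datatype node = N1 | N2

text \<open>The pair (a, b) stands for the element of the weight lattice with coordinates a, b in the
  basis of simple roots.\<close>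

type_synonym weight = "int \<times> int"

fun simple_root :: "node \<Rightarrow> weight" where
  "simple_root N1 = (1, 0)"
| "simple_root N2 = (0, 1)"

text \<open>Pairing with the simple coroots: the second simple root pairs to -3 with the first coroot,
  the first simple root pairs to -1 with the second coroot.\<close>

fun coroot_pairing :: "weight \<Rightarrow> node \<Rightarrow> int" where
  "coroot_pairing (a, b) N1 = 2 * a - 3 * b"
| "coroot_pairing (a, b) N2 = - a + 2 * b"

definition simple_refl :: "node \<Rightarrow> weight \<Rightarrow> weight" where
  "simple_refl i l =
     (fst l - coroot_pairing l i * fst (simple_root i),
      snd l - coroot_pairing l i * snd (simple_root i))"

definition weyl_w0 :: "weight \<Rightarrow> weight" where
  "weyl_w0 = simple_refl N1 \<circ> simple_refl N2 \<circ> simple_refl N1 \<circ> simple_refl N2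
             \<circ> simple_refl N1 \<circ> simple_refl N2"

text \<open>An element t of the torus is represented by the function sending a lattice element l to
  t(X^l). The following is the homomorphism with prescribed nonzero values z, w on the two simple
  roots.\<close>

definition torus_point :: "complex \<Rightarrow> complex \<Rightarrow> weight \<Rightarrow> complex" where
  "torus_point z w l = z powi fst l * w powi snd l"

definition weyl_act :: "(weight \<Rightarrow> weight) \<Rightarrow> (weight \<Rightarrow> complex) \<Rightarrow> weight \<Rightarrow> complex" where
  "weyl_act w t l = t (inv_into UNIV w l)"

section \<open>The affine Hecke algebra, by generators and relations\<close>

text \<open>The free monoid on a type, written additively so that finitely supported functions on it
  form the free algebra, with the convolution product of \<open>Poly_Mapping\<close>.\<close>

datatype 'a free_monoid = Word (letters: "'a list")

instantiation free_monoid :: (type) monoid_add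
begin
definition "0 = Word []"
definition "u + v = Word (letters u @ letters v)"
instance
  by standard (simp_all add: zero_free_monoid_def plus_free_monoid_def)
end

datatype hecke_gen = GT node | GX weight

type_synonym free_alg = "hecke_gen free_monoid \<Rightarrow>\<^sub>0 complex"

definition free_algebra :: "free_alg ring" where
  "free_algebra = \<lparr>carrier = UNIV, monoid.mult = (*), one = 1, ring.zero = 0, add = (+)\<rparr>"

definition scal :: "complex \<Rightarrow> free_alg" where
  "scal c = Poly_Mapping.single 0 c"

definition genT :: "node \<Rightarrow> free_alg" where
  "genT i = Poly_Mapping.single (Word [GT i]) 1"

definition genX :: "weight \<Rightarrow> free_alg" where
  "genX l = Poly_Mapping.single (Word [GX l]) 1"

text \<open>The group algebra C[X] is the convolution algebra of finitely supported functions on the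
  lattice; this is its linear lift to the free algebra.\<close>

type_synonym group_alg = "weight \<Rightarrow>\<^sub>0 complex"

definition monoX :: "weight \<Rightarrow> group_alg" where
  "monoX l = Poly_Mapping.single l 1"

definition lift_group_alg :: "group_alg \<Rightarrow> free_alg" where
  "lift_group_alg f =
     (\<Sum>l\<in>Poly_Mapping.keys f. scal (Poly_Mapping.lookup f l) * genX l)"

text \<open>In \<open>bernstein\<close>, the element f of C[X] is the quotient of X^l - X^(s_i l) by 1 - X^(-alpha_i);
  it is unique because C[X] is a domain.\<close>

inductive_set hecke_rels :: "complex \<Rightarrow> free_alg set" for q :: complex where
  X_zero: "genX 0 - 1 \<in> hecke_rels q"
| X_add: "genX l * genX m - genX (l + m) \<in> hecke_rels q"
| quadratic: "genT i * genT i - (scal (q - inverse q) * genT i + 1) \<in> hecke_rels q"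
| braid: "genT N1 * genT N2 * genT N1 * genT N2 * genT N1 * genT N2
          - genT N2 * genT N1 * genT N2 * genT N1 * genT N2 * genT N1 \<in> hecke_rels q"
| bernstein: "f * (1 - monoX (- simple_root i)) = monoX l - monoX (simple_refl i l) \<Longrightarrow>
    genX l * genT i
    - (genT i * genX (simple_refl i l) + scal (q - inverse q) * lift_group_alg f) \<in> hecke_rels q"

definition hecke :: "complex \<Rightarrow> free_alg set ring" where
  "hecke q = free_algebra Quot (Idl\<^bsub>free_algebra\<^esub> (hecke_rels q))"

definition hecke_of :: "complex \<Rightarrow> free_alg \<Rightarrow> free_alg set" where
  "hecke_of q x = Idl\<^bsub>free_algebra\<^esub> (hecke_rels q) +>\<^bsub>free_algebra\<^esub> x"

text \<open>The image of C[X] contains the scalars, so the subring generated below is the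
  subalgebra generated by T_i and C[X].\<close>

definition hecke_parabolic :: "complex \<Rightarrow> node \<Rightarrow> free_alg set ring" where
  "hecke_parabolic q i = (hecke q)\<lparr>carrier :=
     generate_ring (hecke q)
       (insert (hecke_of q (genT i)) (range (\<lambda>f. hecke_of q (lift_group_alg f))))\<rparr>"

section \<open>Modules over noncommutative rings and induction\<close>

text \<open>The library locale \<open>module\<close> requires a commutative ring; the axioms are the same here.\<close>

locale left_module = R?: ring R + M?: abelian_group M
  for R :: "('a, 'r) ring_scheme" (structure) and M :: "('a, 'b, 'm) module_scheme" (structure) +
  assumes lsmult_closed:
      "\<lbrakk>a \<in> carrier R; x \<in> carrier M\<rbrakk> \<Longrightarrow> a \<odot>\<^bsub>M\<^esub> x \<in> carrier M"
    and lsmult_l_distr: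
      "\<lbrakk>a \<in> carrier R; b \<in> carrier R; x \<in> carrier M\<rbrakk> \<Longrightarrow>
        (a \<oplus>\<^bsub>R\<^esub> b) \<odot>\<^bsub>M\<^esub> x = a \<odot>\<^bsub>M\<^esub> x \<oplus>\<^bsub>M\<^esub> b \<odot>\<^bsub>M\<^esub> x"
    and lsmult_r_distr:
      "\<lbrakk>a \<in> carrier R; x \<in> carrier M; y \<in> carrier M\<rbrakk> \<Longrightarrow>
        a \<odot>\<^bsub>M\<^esub> (x \<oplus>\<^bsub>M\<^esub> y) = a \<odot>\<^bsub>M\<^esub> x \<oplus>\<^bsub>M\<^esub> a \<odot>\<^bsub>M\<^esub> y"
    and lsmult_assoc:
      "\<lbrakk>a \<in> carrier R; b \<in> carrier R; x \<in> carrier M\<rbrakk> \<Longrightarrow>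
        (a \<otimes>\<^bsub>R\<^esub> b) \<odot>\<^bsub>M\<^esub> x = a \<odot>\<^bsub>M\<^esub> (b \<odot>\<^bsub>M\<^esub> x)"
    and lsmult_one:
      "x \<in> carrier M \<Longrightarrow> \<one>\<^bsub>R\<^esub> \<odot>\<^bsub>M\<^esub> x = x"

locale irreducible_module = left_module +
  assumes nonzero: "carrier M \<noteq> {\<zero>\<^bsub>M\<^esub>}"
    and submodule_trivial:
      "submodule N R M \<Longrightarrow> N = {\<zero>\<^bsub>M\<^esub>} \<or> N = carrier M"

text \<open>Defining relations of the tensor product of R, as a right module over its subring S,
  with the left S-module V, inside the free abelian group on pairs.\<close>

definition tensor_rels ::
  "('r, 'm) ring_scheme \<Rightarrow> ('r, 'n) ring_scheme \<Rightarrow> ('r, 'v, 'k) module_scheme \<Rightarrow>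
   ('r \<times> 'v \<Rightarrow>\<^sub>0 int) set" where
  "tensor_rels R S V =
     {frag_of (a \<oplus>\<^bsub>R\<^esub> b, v) - (frag_of (a, v) + frag_of (b, v)) | a b v.
        a \<in> carrier R \<and> b \<in> carrier R \<and> v \<in> carrier V}
   \<union> {frag_of (a, v \<oplus>\<^bsub>V\<^esub> w) - (frag_of (a, v) + frag_of (a, w)) | a v w.
        a \<in> carrier R \<and> v \<in> carrier V \<and> w \<in> carrier V}
   \<union> {frag_of (a \<otimes>\<^bsub>R\<^esub> s, v) - frag_of (a, s \<odot>\<^bsub>V\<^esub> v) | a s v.
        a \<in> carrier R \<and> s \<in> carrier S \<and> v \<in> carrier V}"

definition tensor_group ::
  "('r, 'm) ring_scheme \<Rightarrow> ('r, 'n) ring_scheme \<Rightarrow> ('r, 'v, 'k) module_scheme \<Rightarrow>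
   ('r \<times> 'v \<Rightarrow>\<^sub>0 int) set monoid" where
  "tensor_group R S V =
     (let F = free_Abelian_group (carrier R \<times> carrier V)
      in F Mod generate F (tensor_rels R S V))"

definition left_mult ::
  "('r, 'm) ring_scheme \<Rightarrow> 'r \<Rightarrow> ('r \<times> 'v \<Rightarrow>\<^sub>0 int) \<Rightarrow> ('r \<times> 'v \<Rightarrow>\<^sub>0 int)" where
  "left_mult R a = frag_extend (\<lambda>(b, v). frag_of (a \<otimes>\<^bsub>R\<^esub> b, v))"

text \<open>The product of cosets in the scalar multiplication is the sum of the subgroup of relations
  with the image of C, that is, the coset of a x for any x in C. The
  multiplicative fields inherited by the library record of modules are irrelevant.\<close>

definition induced_module ::
  "('r, 'm) ring_scheme \<Rightarrow> ('r, 'n) ring_scheme \<Rightarrow> ('r, 'v, 'k) module_scheme \<Rightarrow>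
   ('r, ('r \<times> 'v \<Rightarrow>\<^sub>0 int) set) module" where
  "induced_module R S V =
     \<lparr>carrier = carrier (tensor_group R S V),
      monoid.mult = undefined, one = undefined,
      ring.zero = \<one>\<^bsub>tensor_group R S V\<^esub>,
      add = monoid.mult (tensor_group R S V),
      smult = (\<lambda>a C. \<one>\<^bsub>tensor_group R S V\<^esub>
                 <#>\<^bsub>free_Abelian_group (carrier R \<times> carrier V)\<^esub> (left_mult R a ` C))\<rparr>"

section \<open>One-dimensional modules of the parabolic subalgebras\<close>

text \<open>The underlying vector space is the complex line with basis vector 1, on which T_i
  acts by c and X^l acts by t(X^l); the scalars of the algebra act as scalars.\<close>

definition one_dim_module ::
  "complex \<Rightarrow> node \<Rightarrow> complex \<Rightarrow> (weight \<Rightarrow> complex) \<Rightarrow> (free_alg set, complex) module \<Rightarrow> bool" where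
  "one_dim_module q i c t V \<longleftrightarrow>
     left_module (hecke_parabolic q i) V \<and>
     carrier V = UNIV \<and> \<zero>\<^bsub>V\<^esub> = 0 \<and> add V = (+) \<and>
     (\<forall>a z. hecke_of q (scal a) \<odot>\<^bsub>V\<^esub> z = a * z) \<and>
     hecke_of q (genT i) \<odot>\<^bsub>V\<^esub> 1 = c \<and>
     (\<forall>l. hecke_of q (genX l) \<odot>\<^bsub>V\<^esub> 1 = t l)"

definition primitive_root_of_unity :: "nat \<Rightarrow> complex \<Rightarrow> bool" where
  "primitive_root_of_unity n z \<longleftrightarrow> n > 0 \<and> z ^ n = 1 \<and> (\<forall>k. 0 < k \<and> k < n \<longrightarrow> z ^ k \<noteq> 1)"

end

theory Submission
  imports Defs
begin

text \<open>Write c for q - 1/q. The defining relations depend on q only through c, which is unchanged when q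
  is replaced by -1/q; moreover w0 = -1, so that w0 t is the point with coordinates (p^2, 1) for
  p = -1/q, and p^2 is again a primitive third root of unity. Hence N for the parameter q is M for
  the parameter -1/q, and only M has to be treated (\<open>hecke_rels_eq\<close>, \<open>weyl_act_w0\<close>).

  Let v be the generator of M. By the Bernstein relation the X's can be moved to the right of the
  T's, and the quadratic and braid relations then reduce every word in the T's, so M is spanned by
  the six vectors e0 = v, e1 = T2 v, e2 = T1 T2 v, ..., e5 = T2 T1 T2 T1 T2 v, one for each minimal
  coset representative of W0 modulo the subgroup of s1 (\<open>all_spanned\<close>). That these vectors are
  independent, and that the character of the parabolic subalgebra exists at all, is seen by writing
  down the representation on the space of coordinates: the action of T1, T2 and of the fundamental
  weights by explicit matrices, whose entries lie in Z[q] because 1/q = -q - q^3. The fundamental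
  weights suffice because the Bernstein relation is multiplicative in the lattice element
  (\<open>bernstein_op_exists\<close>, \<open>hecke_rels_act\<close>). Consequently the left ideal annihilating v is
  exactly the left ideal annihilating e0 in this representation (\<open>annihilator_iff\<close>), and M
  is identified with the coordinate space.

  Irreducibility comes from one element of the algebra. Since q^4 + q^2 + 1 = 0, every long root takes
  the value 1 at t, so t is fixed by a subgroup of order six of W0 and M has only the weights t (four
  times) and 1/t (twice). Let omega2 be the fundamental weight (3, 2), the highest root. It is a
  long root, so X^omega2 acts unipotently, and (X^omega2 - 1)^2 turns out to be -9 q^3 times the
  matrix unit sending e5 to e0 (\<open>rank_one\<close>). Acting on a nonzero vector by suitable products of T1
  and T2 one can make its last coordinate nonzero (\<open>coord5_nonzero\<close>); applying the rank one operator
  afterwards gives the generator e0. Every nonzero vector therefore generates M.\<close>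

section \<open>Linear extension and representations of monoid algebras\<close>

text \<open>The coefficients act through an arbitrary function, so that the same construction
  serves complex combinations of operators and integral combinations of pure tensors.\<close>

definition linear_extension ::
  "('c \<Rightarrow> 'v \<Rightarrow> 'v) \<Rightarrow> ('k \<Rightarrow> 'v) \<Rightarrow> ('k \<Rightarrow>\<^sub>0 'c::zero) \<Rightarrow> 'v::comm_monoid_add" where
  "linear_extension sc g p =
     (\<Sum>k\<in>Poly_Mapping.keys p. sc (Poly_Mapping.lookup p k) (g k))"

lemma linear_extension_superset:
  assumes "finite K" "Poly_Mapping.keys p \<subseteq> K" "\<And>v. sc 0 v = 0"
  shows "linear_extension sc g p = (\<Sum>k\<in>K. sc (Poly_Mapping.lookup p k) (g k))"
  unfolding linear_extension_def
  using assms by (intro sum.mono_neutral_left) (auto simp: in_keys_iff)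

lemma linear_extension_0 [simp]: "linear_extension sc g 0 = 0"
  by (simp add: linear_extension_def)

lemma linear_extension_single:
  assumes "\<And>v. sc 0 v = 0"
  shows "linear_extension sc g (Poly_Mapping.single k a) = sc a (g k)"
  by (subst linear_extension_superset [of "{k}"]) (auto simp: assms)

lemma linear_extension_add:
  fixes sc :: "'c::monoid_add \<Rightarrow> 'v \<Rightarrow> 'v::comm_monoid_add"
  assumes "\<And>v. sc 0 v = 0" "\<And>a b v. sc (a + b) v = sc a v + sc b v"
  shows "linear_extension sc g (p + r) = linear_extension sc g p + linear_extension sc g r"
proof -
  let ?K = "Poly_Mapping.keys p \<union> Poly_Mapping.keys r"
  have "Poly_Mapping.keys (p + r) \<subseteq> ?K" by (rule Poly_Mapping.keys_add)
  then show ?thesis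
    using assms by (simp add: linear_extension_superset [of ?K] lookup_add sum.distrib)
qed

lemma poly_mapping_single_induct [case_names zero single_add]:
  fixes p :: "'k \<Rightarrow>\<^sub>0 'c::comm_monoid_add"
  assumes "P 0"
    and "\<And>k a p. P p \<Longrightarrow> P (Poly_Mapping.single k a + p)"
  shows "P p"
proof (induction p rule: update_induct)
  case const
  then show ?case by (rule assms(1))
next
  case (update p k a)
  have "Poly_Mapping.update k a p = Poly_Mapping.single k a + p"
    using update.hyps(1) 
    by (intro poly_mapping_eqI) (auto simp: lookup_update lookup_add lookup_single in_keys_iff when_def)
  then show ?case using assms(2) update by simp
qed

text \<open>Both the free algebra (over the free monoid) and C[X] (over the weight
  lattice) act on a vector space by extending the action of the underlying monoid linearly.\<close>

locale monoid_representation = vector_space scale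
  for scale :: "complex \<Rightarrow> 'v::ab_group_add \<Rightarrow> 'v" +
  fixes act :: "'m::monoid_add \<Rightarrow> 'v \<Rightarrow> 'v"
  assumes act_zero: "act 0 v = v"
    and act_plus: "act (m + n) v = act m (act n v)"
    and act_add: "act m (v + w) = act m v + act m w"
    and act_scale: "act m (scale c v) = scale c (act m v)"
begin

definition algebra_act :: "('m \<Rightarrow>\<^sub>0 complex) \<Rightarrow> 'v \<Rightarrow> 'v" where
  "algebra_act p v = linear_extension scale (\<lambda>m. act m v) p"

lemma algebra_act_0 [simp]: "algebra_act 0 v = 0"
  by (simp add: algebra_act_def)

lemma algebra_act_single: "algebra_act (Poly_Mapping.single m c) v = scale c (act m v)"
  by (simp add: algebra_act_def linear_extension_single)

lemma algebra_act_1 [simp]: "algebra_act 1 v = v"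
  using algebra_act_single [of 0 1] by (simp add: act_zero)

lemma algebra_act_plus: "algebra_act (p + r) v = algebra_act p v + algebra_act r v"
  unfolding algebra_act_def by (rule linear_extension_add) (simp_all add: scale_left_distrib)

lemma algebra_act_diff: "algebra_act (p - r) v = algebra_act p v - algebra_act r v"
  using algebra_act_plus [of "p - r" r v] by simp

lemma algebra_act_minus: "algebra_act (- p) v = - algebra_act p v"
  using algebra_act_diff [of 0 p v] by simp

lemma algebra_act_add: "algebra_act p (v + w) = algebra_act p v + algebra_act p w"
  by (induction p rule: poly_mapping_single_induct)
    (simp_all add: algebra_act_plus algebra_act_single act_add scale_right_distrib)

lemma algebra_act_scale: "algebra_act p (scale c v) = scale c (algebra_act p v)"
  by (induction p rule: poly_mapping_single_induct)
    (simp_all add: algebra_act_plus algebra_act_single act_scale scale_right_distrib mult.commute)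

lemma algebra_act_zero_right [simp]: "algebra_act p 0 = 0"
  using algebra_act_add [of p 0 0] by simp

lemma algebra_act_times: "algebra_act (p * r) v = algebra_act p (algebra_act r v)"
proof (induction p rule: poly_mapping_single_induct)
  case zero
  show ?case by simp
next
  case (single_add m c p)
  have "algebra_act (Poly_Mapping.single m c * r) v = scale c (act m (algebra_act r v))"
  proof (induction r rule: poly_mapping_single_induct)
    case zero
    show ?case using act_scale [of m 0 0] by simp
  next
    case (single_add n d r)
    then show ?case
      by (simp add: algebra_simps algebra_act_plus mult_single algebra_act_single act_add act_plus
          act_scale)
  qed
  then show ?case
    using single_add by (simp add: distrib_right algebra_act_plus algebra_act_single)
qed

end

section \<open>Matrices for the generators\<close>

text \<open>A tuple holds the coordinates with respect to the basis e0 = v, e1 = T2 v, e2 = T1 T2 v, ...,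
  e5 = T2 T1 T2 T1 T2 v of M.\<close>

type_synonym vec6 = "complex \<times> complex \<times> complex \<times> complex \<times> complex \<times> complex"

fun scale6 :: "complex \<Rightarrow> vec6 \<Rightarrow> vec6" where
  "scale6 z (a0, a1, a2, a3, a4, a5) = (z * a0, z * a1, z * a2, z * a3, z * a4, z * a5)"

text \<open>The last entry for T1 is the braid relation: T1 e5 = T1 T2 T1 T2 T1 T2 v = T2 T1 T2 T1 T2 T1 v, which
  is q e5. All other entries record how the chain is extended or, by the quadratic relation,
  shortened.\<close>

fun T_op :: "complex \<Rightarrow> node \<Rightarrow> vec6 \<Rightarrow> vec6" where
  "T_op q N1 (a0, a1, a2, a3, a4, a5) =
     (q * a0, a2, a1 + (q - inverse q) * a2, a4, a3 + (q - inverse q) * a4, q * a5)"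
| "T_op q N2 (a0, a1, a2, a3, a4, a5) =
     (a1, a0 + (q - inverse q) * a1, a3, a2 + (q - inverse q) * a3, a5, a4 + (q - inverse q) * a5)"

text \<open>The operators of the fundamental weights omega1 = (2, 1) and omega2 = (3, 2) and their inverses. The
  image of e_k is found by moving X^omega to the right of the k factors T with the Bernstein relation,
  letting the resulting elements of C[X] act on v, and reducing with q^4 = - q^2 - 1. In particular
  X^omega1 acts on v by q^4 = - 1 - q^2 and X^omega2 by q^6 = 1.\<close>

fun X1_op :: "complex \<Rightarrow> vec6 \<Rightarrow> vec6" where
  "X1_op q (a0, a1, a2, a3, a4, a5) =
     ((- 1 - q^2) * a0 + (- 1 - 2 * q^2) * a2 + (- q - 2 * q^3) * a3 + (1 + 2 * q^2) * a4 + (2 * q + q^3) * a5,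
      (- 1 - q^2) * a1 + (- q - 2 * q^3) * a2 + (2 + q^2) * a3 + (2 * q + q^3) * a4 + (- 2 + 2 * q^2) * a5,
      q^2 * a2 + (- 1 + q^2) * a4 + (- q + q^3) * a5,
      q^2 * a3 + (- q + q^3) * a4 + (- 1 - 2 * q^2) * a5,
      (- 1 - q^2) * a4,
      (- 1 - q^2) * a5)"

fun X1_inv_op :: "complex \<Rightarrow> vec6 \<Rightarrow> vec6" where
  "X1_inv_op q (a0, a1, a2, a3, a4, a5) =
     (q^2 * a0 + (1 + 2 * q^2) * a2 + (q + 2 * q^3) * a3 + (- 4 - 2 * q^2) * a4 + (- 2 * q - q^3) * a5,
      q^2 * a1 + (q + 2 * q^3) * a2 + (- 2 - q^2) * a3 + (- 2 * q - q^3) * a4 + (- 1 - 2 * q^2) * a5,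
      (- 1 - q^2) * a2 + (1 - q^2) * a4 + (q - q^3) * a5,
      (- 1 - q^2) * a3 + (q - q^3) * a4 + (1 + 2 * q^2) * a5,
      q^2 * a4,
      q^2 * a5)"

fun X2_op :: "complex \<Rightarrow> vec6 \<Rightarrow> vec6" where
  "X2_op q (a0, a1, a2, a3, a4, a5) =
     (a0 + (2 * q + q^3) * a1 + (- 1 + q^2) * a2 + (- 3 * q) * a3 + (- 3 * q^2) * a4 + (q - 4 * q^3) * a5,
      a1 + (1 - q^2) * a3 + (2 * q + q^3) * a4 + (- 3 - 3 * q^2) * a5,
      a2 + (2 * q + q^3) * a3 + (- 2 - q^2) * a4 + (- 3 * q - 3 * q^3) * a5,
      a3 + (2 + q^2) * a5,
      a4 + (2 * q + q^3) * a5,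
      a5)"

fun X2_inv_op :: "complex \<Rightarrow> vec6 \<Rightarrow> vec6" where
  "X2_inv_op q (a0, a1, a2, a3, a4, a5) =
     (a0 + (- 2 * q - q^3) * a1 + (1 - q^2) * a2 + (3 * q) * a3 + (3 * q^2) * a4 + (- q - 5 * q^3) * a5,
      a1 + (- 1 + q^2) * a3 + (- 2 * q - q^3) * a4 + (3 + 3 * q^2) * a5,
      a2 + (- 2 * q - q^3) * a3 + (2 + q^2) * a4 + (3 * q + 3 * q^3) * a5,
      a3 + (- 2 - q^2) * a5,
      a4 + (- 2 * q - q^3) * a5,
      a5)"

lemma vector_space_scale6: "vector_space scale6"
  by unfold_locales (auto simp: algebra_simps add_Pair)

text \<open>The integral power of F when G is its inverse.\<close>

definition int_iterate :: "('v \<Rightarrow> 'v) \<Rightarrow> ('v \<Rightarrow> 'v) \<Rightarrow> int \<Rightarrow> 'v \<Rightarrow> 'v" where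
  "int_iterate F G n = (if n \<ge> 0 then F ^^ nat n else G ^^ nat (- n))"

text \<open>The equation says that q^2 is a primitive third root of unity.\<close>

locale cubic_parameter =
  fixes q :: complex
  assumes root: "q ^ 4 + q ^ 2 + 1 = 0"
begin

lemma q_power4: "q * (q * (q * q)) = - (q * q) - 1"
proof -
  have "q * (q * (q * q)) = q ^ 4" by (simp add: eval_nat_numeral)
  also have "\<dots> = - (q ^ 2 + 1)" using root by (simp only: eq_neg_iff_add_eq_0 add.assoc)
  also have "\<dots> = - (q * q) - 1" by (simp add: power2_eq_square)
  finally show ?thesis .
qed

lemma q_power4_left: "q * (q * (q * (q * x))) = - (q * (q * x)) - x"
proof -
  have "q * (q * (q * (q * x))) = (q * (q * (q * q))) * x" by (simp add: mult.assoc)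
  then show ?thesis by (simp add: q_power4 algebra_simps)
qed

lemma q_nonzero: "q \<noteq> 0"
  using root by (intro notI) simp

lemma inverse_q: "inverse q = - q - q * (q * q)"
proof (rule inverse_unique)
  show "q * (- q - q * (q * q)) = 1" 
    by (simp add: algebra_simps q_power4)
qed

text \<open>With powers of q expanded into products and products sorted, the two rules for q^4 bring every
  polynomial expression in q to the normal form of degree below four, which decides all identities
  between the matrices.\<close>

lemmas reduce_q = inverse_q eval_nat_numeral algebra_simps q_power4 q_power4_left

lemma X1_inv: "X1_op q (X1_inv_op q v) = v" "X1_inv_op q (X1_op q v) = v"
  by (cases v; simp add: reduce_q)+

lemma X2_inv: "X2_op q (X2_inv_op q v) = v" "X2_inv_op q (X2_op q v) = v"
  by (cases v; simp add: reduce_q)+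

lemma X_commute: "X1_op q (X2_op q v) = X2_op q (X1_op q v)"
  by (cases v; simp add: reduce_q)+

lemma X1_T2: "X1_op q (T_op q N2 v) = T_op q N2 (X1_op q v)"
  by (cases v; simp add: reduce_q)

lemma X2_T1: "X2_op q (T_op q N1 v) = T_op q N1 (X2_op q v)"
  by (cases v; simp add: reduce_q)+

text \<open>The Bernstein relations for the fundamental weights. Each fundamental weight commutes with one of
  T1, T2; for the other one s1 omega1 = - omega1 + omega2 and s2 omega2 = 3 omega1 - omega2.\<close>

lemma X1_T1: "X1_op q (T_op q N1 v) =
   T_op q N1 (X1_inv_op q (X2_op q v)) + scale6 (q - inverse q) (X1_op q v)"
  by (cases v; simp add: reduce_q add_Pair)+

lemma X2_T2: "X2_op q (T_op q N2 v) =
   T_op q N2 (X1_op q (X1_op q (X1_op q (X2_inv_op q v)))) + scale6 (q - inverse q) (X2_op q v)"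
  by (cases v; simp add: reduce_q add_Pair)+

lemma T_quadratic: "T_op q i (T_op q i v) = scale6 (q - inverse q) (T_op q i v) + v"
  by (cases v; cases i; simp add: reduce_q add_Pair)+

lemma T_braid:
  "T_op q N1 (T_op q N2 (T_op q N1 (T_op q N2 (T_op q N1 (T_op q N2 v))))) =
   T_op q N2 (T_op q N1 (T_op q N2 (T_op q N1 (T_op q N2 (T_op q N1 v)))))"
  by (cases v; simp add: reduce_q add_Pair)+

end

section \<open>The action of the weight lattice\<close>

lemma T_op_linear:
  "T_op q i (v + w) = T_op q i v + T_op q i w"
  "T_op q i (scale6 z v) = scale6 z (T_op q i v)"
  by (cases v; cases w; cases i; simp add: algebra_simps)+

lemma X1_op_linear:
  "X1_op q (v + w) = X1_op q v + X1_op q w" "X1_op q (scale6 z v) = scale6 z (X1_op q v)"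
  "X1_inv_op q (v + w) = X1_inv_op q v + X1_inv_op q w"
  "X1_inv_op q (scale6 z v) = scale6 z (X1_inv_op q v)"
  by (cases v; cases w; simp add: algebra_simps)+

lemma X2_op_linear:
  "X2_op q (v + w) = X2_op q v + X2_op q w" "X2_op q (scale6 z v) = scale6 z (X2_op q v)"
  "X2_inv_op q (v + w) = X2_inv_op q v + X2_inv_op q w"
  "X2_inv_op q (scale6 z v) = scale6 z (X2_inv_op q v)"
  by (cases v; cases w; simp add: algebra_simps)+

lemma int_iterate_0 [simp]: "int_iterate F G 0 v = v"
  by (simp add: int_iterate_def)

lemma int_iterate_1 [simp]: "int_iterate F G 1 v = F v" "int_iterate F G (- 1) v = G v"
  by (simp_all add: int_iterate_def)

context
  fixes F G :: "'v \<Rightarrow> 'v"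
  assumes inv: "\<And>v. F (G v) = v" "\<And>v. G (F v) = v"
begin

lemma int_iterate_Suc: "int_iterate F G (n + 1) v = F (int_iterate F G n v)"
proof (cases "n \<ge> 0")
  case True
  then show ?thesis by (simp add: int_iterate_def nat_add_distrib)
next
  case False
  define m where "m = nat (- (n + 1))"
  with False have n: "n = - int (Suc m)" by simp
  show ?thesis by (cases m) (simp_all add: n int_iterate_def nat_add_distrib inv)
qed

lemma int_iterate_pred: "int_iterate F G (n - 1) v = G (int_iterate F G n v)"
  using int_iterate_Suc [of "n - 1" v] by (simp add: inv)

lemma int_iterate_add: "int_iterate F G (m + n) v = int_iterate F G m (int_iterate F G n v)"
proof (induction m rule: int_induct [of _ 0])
  case base
  then show ?case by simp
next
  case (step1 m)
  then show ?case using int_iterate_Suc [of "m + n" v] int_iterate_Suc [of m]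
    by (simp add: algebra_simps)
next
  case (step2 m)
  then show ?case using int_iterate_pred [of "m + n" v] int_iterate_pred [of m]
    by (simp add: algebra_simps)
qed

end

lemma int_iterate_commute:
  assumes "\<And>v. F (H v) = H (F v)" "\<And>v. G (H v) = H (G v)"
  shows "int_iterate F G n (H v) = H (int_iterate F G n v)"
proof -
  have "(F ^^ k) (H v) = H ((F ^^ k) v)" "(G ^^ k) (H v) = H ((G ^^ k) v)" for k
    by (induction k) (simp_all add: assms)
  then show ?thesis by (simp add: int_iterate_def)
qed

text \<open>The simple coroots are dual to the fundamental weights, so they give the exponents of the
  two commuting fundamental operators.\<close>

definition weight_op :: "complex \<Rightarrow> weight \<Rightarrow> vec6 \<Rightarrow> vec6" where
  "weight_op q l v =
     int_iterate (X1_op q) (X1_inv_op q) (coroot_pairing l N1)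
       (int_iterate (X2_op q) (X2_inv_op q) (coroot_pairing l N2) v)"

lemma int_iterate_X_linear:
  "int_iterate (X1_op q) (X1_inv_op q) n (v + w) =
   int_iterate (X1_op q) (X1_inv_op q) n v + int_iterate (X1_op q) (X1_inv_op q) n w"
  "int_iterate (X2_op q) (X2_inv_op q) n (v + w) =
   int_iterate (X2_op q) (X2_inv_op q) n v + int_iterate (X2_op q) (X2_inv_op q) n w"
  "int_iterate (X1_op q) (X1_inv_op q) n (scale6 z v) =
   scale6 z (int_iterate (X1_op q) (X1_inv_op q) n v)"
  "int_iterate (X2_op q) (X2_inv_op q) n (scale6 z v) =
   scale6 z (int_iterate (X2_op q) (X2_inv_op q) n v)"
proof -
  have "(X1_op q ^^ k) (v + w) = (X1_op q ^^ k) v + (X1_op q ^^ k) w"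
    "(X2_op q ^^ k) (v + w) = (X2_op q ^^ k) v + (X2_op q ^^ k) w"
    "(X1_inv_op q ^^ k) (v + w) = (X1_inv_op q ^^ k) v + (X1_inv_op q ^^ k) w"
    "(X2_inv_op q ^^ k) (v + w) = (X2_inv_op q ^^ k) v + (X2_inv_op q ^^ k) w" for k
    by (induction k) (simp_all add: X1_op_linear X2_op_linear)
  then show
    "int_iterate (X1_op q) (X1_inv_op q) n (v + w) =
     int_iterate (X1_op q) (X1_inv_op q) n v + int_iterate (X1_op q) (X1_inv_op q) n w"
    "int_iterate (X2_op q) (X2_inv_op q) n (v + w) =
     int_iterate (X2_op q) (X2_inv_op q) n v + int_iterate (X2_op q) (X2_inv_op q) n w"
    by (simp_all add: int_iterate_def)
qed (simp_all add: int_iterate_commute X1_op_linear X2_op_linear)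

lemma coroot_pairing_add: "coroot_pairing (l + m) i = coroot_pairing l i + coroot_pairing m i"
  by (cases l; cases m; cases i) auto

lemma coroot_pairing_uminus: "coroot_pairing (- l) i = - coroot_pairing l i"
  by (cases l; cases i) auto

lemma simple_refl_add: "simple_refl i (l + m) = simple_refl i l + simple_refl i m"
  by (cases i) (simp_all add: simple_refl_def coroot_pairing_add prod_eq_iff)

lemma simple_refl_uminus: "simple_refl i (- l) = - simple_refl i l"
  by (cases i) (simp_all add: simple_refl_def coroot_pairing_uminus prod_eq_iff)

text \<open>The fundamental weights (2, 1) and (3, 2) are a basis of the lattice, since
  2 * 2 - 1 * 3 = 1.\<close>

lemma weight_induct [case_names omega1 omega2 add uminus]:
  assumes w1: "P (2, 1)" and w2: "P (3, 2)"
    and add: "\<And>l m. P l \<Longrightarrow> P m \<Longrightarrow> P (l + m)" and uminus: "\<And>l. P l \<Longrightarrow> P (- l)"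
  shows "P (l :: weight)"
proof -
  have zero: "P 0" using add [OF w1 uminus [OF w1]] by (simp add: zero_prod_def)
  have multiple: "P (n * a, n * b)" if "P (a, b)" for a b n
  proof (induction n rule: int_induct [of _ 0])
    case base
    then show ?case using zero by (simp add: zero_prod_def)
  next
    case (step1 n)
    then show ?case using add [OF step1(2) that] by (simp add: algebra_simps)
  next
    case (step2 n)
    then show ?case using add [OF step2(2) uminus [OF that]] by (simp add: algebra_simps)
  qed
  obtain a b where l: "l = (a, b)" by (cases l)
  have "l = ((2 * a - 3 * b) * 2, (2 * a - 3 * b) * 1) + ((2 * b - a) * 3, (2 * b - a) * 2)"
    by (simp add: l algebra_simps)
  then show ?thesis using add [OF multiple [OF w1] multiple [OF w2]] by metis
qed

section \<open>The quotients in the Bernstein relation\<close>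

definition bernstein_quotient :: "node \<Rightarrow> weight \<Rightarrow> group_alg \<Rightarrow> bool" where
  "bernstein_quotient i l f \<longleftrightarrow>
     f * (1 - monoX (- simple_root i)) = monoX l - monoX (simple_refl i l)"

lemma monoX_mult: "monoX l * monoX m = monoX (l + m)"
  by (simp add: monoX_def mult_single)

text \<open>A Leibniz rule:
  X^(l+m) - X^(s(l+m)) = (X^l - X^(s l)) X^(s m) + X^l (X^m - X^(s m)).\<close>

lemma bernstein_quotient_add:
  assumes "bernstein_quotient i l f" "bernstein_quotient i m g"
  shows "bernstein_quotient i (l + m) (f * monoX (simple_refl i m) + monoX l * g)"
proof -
  let ?d = "1 - monoX (- simple_root i)"
  have "(f * monoX (simple_refl i m) + monoX l * g) * ?d =
        (f * ?d) * monoX (simple_refl i m) + monoX l * (g * ?d)"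
    by (simp add: algebra_simps)
  also have "\<dots> = (monoX l - monoX (simple_refl i l)) * monoX (simple_refl i m)
       + monoX l * (monoX m - monoX (simple_refl i m))"
    using assms by (simp add: bernstein_quotient_def)
  also have "\<dots> = monoX (l + m) - monoX (simple_refl i (l + m))"
    by (simp add: algebra_simps monoX_mult simple_refl_add)
  finally show ?thesis by (simp add: bernstein_quotient_def)
qed

lemma bernstein_quotient_uminus:
  assumes "bernstein_quotient i l f"
  shows "bernstein_quotient i (- l) (- (monoX (- l) * f * monoX (- simple_refl i l)))"
proof -
  let ?d = "1 - monoX (- simple_root i)"
  have "- (monoX (- l) * f * monoX (- simple_refl i l)) * ?d
      = - (monoX (- l) * (f * ?d) * monoX (- simple_refl i l))"
    by (simp add: algebra_simps)
  also have "\<dots> = - (monoX (- l) * (monoX l - monoX (simple_refl i l)) * monoX (- simple_refl i l))"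
    using assms by (simp add: bernstein_quotient_def)
  also have "\<dots> = monoX (- l) - monoX (simple_refl i (- l))"
    by (simp add: algebra_simps monoX_mult simple_refl_uminus)
  finally show ?thesis by (simp add: bernstein_quotient_def)
qed

lemma bernstein_quotient_fundamental:
  "bernstein_quotient N1 (2, 1) (monoX (2, 1))" "bernstein_quotient N1 (3, 2) 0"
  "bernstein_quotient N2 (2, 1) 0" "bernstein_quotient N2 (3, 2) (monoX (3, 2))"
  by (simp_all add: bernstein_quotient_def simple_refl_def algebra_simps monoX_mult)

lemma bernstein_quotient_exists: "\<exists>f. bernstein_quotient i l f"
proof (induction l rule: weight_induct)
  case omega1
  then show ?case by (cases i) (use bernstein_quotient_fundamental in blast)+
next
  case omega2
  then show ?case by (cases i) (use bernstein_quotient_fundamental in blast)+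
next
  case (add l m)
  then show ?case using bernstein_quotient_add by blast
next
  case (uminus l)
  then show ?case using bernstein_quotient_uminus by blast
qed

lemma lookup_mult_monoX:
  "Poly_Mapping.lookup (f * monoX m) l = Poly_Mapping.lookup f (l - m)"
proof (induction f rule: poly_mapping_single_induct)
  case zero
  then show ?case by simp
next
  case (single_add k a f)
  then show ?case
    by (auto simp: distrib_right lookup_add monoX_def mult_single lookup_single when_def)
qed

text \<open>A difference h of two quotients satisfies h = h X^(-alpha), so its coefficients are constant
  along the lines in direction alpha; being finitely supported, it vanishes.\<close>

lemma bernstein_quotient_unique:
  assumes "bernstein_quotient i l f" "bernstein_quotient i l g"
  shows "f = g"
proof (rule ccontr)
  assume "f \<noteq> g"
  define h where "h = f - g"
  have "h * (1 - monoX (- simple_root i)) = 0"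
    using assms by (simp add: h_def bernstein_quotient_def left_diff_distrib)
  then have "h = h * monoX (- simple_root i)" by (simp add: right_diff_distrib)
  then have shift: "Poly_Mapping.lookup h m = Poly_Mapping.lookup h (m + simple_root i)" for m
    by (metis lookup_mult_monoX diff_minus_eq_add)
  from \<open>f \<noteq> g\<close> have "h \<noteq> 0" by (simp add: h_def)
  then obtain m where m: "Poly_Mapping.lookup h m \<noteq> 0"
    by (metis poly_mapping_eqI lookup_zero)
  define s where "s n = m + (int n * fst (simple_root i), int n * snd (simple_root i))" for n :: nat
  have "Poly_Mapping.lookup h (s n) = Poly_Mapping.lookup h m" for n
  proof (induction n)
    case 0
    then show ?case by (simp add: s_def prod_eq_iff flip: zero_prod_def)
  next
    case (Suc n)
    have "s (Suc n) = s n + simple_root i" by (simp add: s_def prod_eq_iff algebra_simps)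
    then show ?case using Suc shift by simp
  qed
  then have "range s \<subseteq> Poly_Mapping.keys h" using m by (auto simp: in_keys_iff)
  moreover have "inj s" by (cases i) (auto simp: s_def inj_def)
  ultimately show False
    using finite_subset [OF _ finite_keys] range_inj_infinite by blast
qed

section \<open>The six-dimensional representation of the Hecke algebra\<close>

fun generator_op :: "complex \<Rightarrow> hecke_gen \<Rightarrow> vec6 \<Rightarrow> vec6" where
  "generator_op q (GT i) = T_op q i"
| "generator_op q (GX l) = weight_op q l"

definition word_op :: "complex \<Rightarrow> hecke_gen free_monoid \<Rightarrow> vec6 \<Rightarrow> vec6" where
  "word_op q w = foldr (generator_op q) (letters w)"

lemma weight_op_linear:
  "weight_op q l (v + w) = weight_op q l v + weight_op q l w"
  "weight_op q l (scale6 z v) = scale6 z (weight_op q l v)"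
  by (simp_all add: weight_op_def int_iterate_X_linear)

lemma generator_op_linear:
  "generator_op q g (v + w) = generator_op q g v + generator_op q g w"
  "generator_op q g (scale6 z v) = scale6 z (generator_op q g v)"
  by (cases g; simp add: T_op_linear weight_op_linear)+

lemma torus_point_add:
  "z \<noteq> 0 \<Longrightarrow> w \<noteq> 0 \<Longrightarrow> torus_point z w (l + m) = torus_point z w l * torus_point z w m"
  by (simp add: torus_point_def power_int_add)

lemma torus_point_uminus: "torus_point z w (- l) = inverse (torus_point z w l)"
  by (simp add: torus_point_def power_int_minus)

lemma torus_point_nonzero: "z \<noteq> 0 \<Longrightarrow> w \<noteq> 0 \<Longrightarrow> torus_point z w l \<noteq> 0"
  by (simp add: torus_point_def)

interpretation scale6: vector_space scale6
  by (rule vector_space_scale6)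

interpretation words: monoid_representation scale6 "word_op q" for q
proof -
  have "foldr (generator_op q) xs (v + w) =
      foldr (generator_op q) xs v + foldr (generator_op q) xs w"
    "foldr (generator_op q) xs (scale6 z v) = scale6 z (foldr (generator_op q) xs v)" for xs z v w
    by (induction xs) (simp_all add: generator_op_linear)
  note linear = this
  show "monoid_representation scale6 (word_op q)"
  proof (intro monoid_representation.intro vector_space_scale6 monoid_representation_axioms.intro)
    show "word_op q 0 v = v" for v by (simp add: word_op_def zero_free_monoid_def)
    show "word_op q (m + n) v = word_op q m (word_op q n v)" for m n v
      by (simp add: word_op_def plus_free_monoid_def)
  qed (simp_all add: word_op_def linear)
qed

definition e0 :: vec6 where "e0 = (1, 0, 0, 0, 0, 0)"

lemma single_act:
  "words.algebra_act q (genT i) v = T_op q i v"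
  "words.algebra_act q (genX l) v = weight_op q l v"
  "words.algebra_act q (scal c) v = scale6 c v"
  by (simp_all add: genT_def genX_def scal_def words.algebra_act_single word_op_def
      zero_free_monoid_def)

context cubic_parameter
begin

lemma X_commute_inv:
  "X1_inv_op q (X2_op q v) = X2_op q (X1_inv_op q v)"
  "X1_op q (X2_inv_op q v) = X2_inv_op q (X1_op q v)"
  "X1_inv_op q (X2_inv_op q v) = X2_inv_op q (X1_inv_op q v)"
  by (metis X_commute X1_inv X2_inv)+

lemma int_iterate_X_commute:
  "int_iterate (X1_op q) (X1_inv_op q) m (int_iterate (X2_op q) (X2_inv_op q) n v) =
   int_iterate (X2_op q) (X2_inv_op q) n (int_iterate (X1_op q) (X1_inv_op q) m v)"
  by (intro int_iterate_commute) (simp_all add: int_iterate_commute X_commute X_commute_inv)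

sublocale weights: monoid_representation scale6 "weight_op q"
proof (intro monoid_representation.intro vector_space_scale6, unfold_locales)
  fix l m v w c
  show "weight_op q 0 v = v" by (simp add: weight_op_def zero_prod_def)
  show "weight_op q (l + m) v = weight_op q l (weight_op q m v)"
    by (simp add: weight_op_def coroot_pairing_add int_iterate_add X1_inv X2_inv
        int_iterate_X_commute)
qed (simp_all add: weight_op_linear)

lemma weight_op_fundamental:
  "weight_op q (2, 1) v = X1_op q v" "weight_op q (3, 2) v = X2_op q v"
  by (simp_all add: weight_op_def)

lemma weight_op_inverse: "weight_op q (- l) (weight_op q l v) = v" 
  "weight_op q l (weight_op q (- l) v) = v"
  by (simp_all add: weights.act_zero flip: weights.act_plus)

lemma algebra_act_monoX: "weights.algebra_act (monoX l) v = weight_op q l v"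
  by (simp add: monoX_def weights.algebra_act_single)

text \<open>The operator form of the Bernstein relation is inherited by sums and
  negatives of weights, by the Leibniz rule for the quotients; it remains to know it for the
  fundamental weights, where it is an identity of matrices.\<close>

lemma bernstein_op_exists:
  "\<exists>f. bernstein_quotient i l f \<and>
       (\<forall>v. weight_op q l (T_op q i v) =
            T_op q i (weight_op q (simple_refl i l) v)
            + scale6 (q - inverse q) (weights.algebra_act f v))"
    (is "\<exists>f. bernstein_quotient i l f \<and> (\<forall>v. ?B l f v)")
proof (induction l rule: weight_induct)
  case omega1
  show ?case
  proof (cases i)
    case N1
    have "weight_op q (1, 1) v = X1_inv_op q (X2_op q v)" for v
      by (simp add: weight_op_def)
    then have "?B (2, 1) (monoX (2, 1)) v" for v
      by (simp add: N1 simple_refl_def weight_op_fundamental algebra_act_monoX X1_T1)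
    then show ?thesis using bernstein_quotient_fundamental(1) N1 by blast
  next
    case N2
    have "?B (2, 1) 0 v" for v
      by (simp add: N2 simple_refl_def weight_op_fundamental X1_T2)
    then show ?thesis using bernstein_quotient_fundamental(3) N2 by blast
  qed
next
  case omega2
  show ?case
  proof (cases i)
    case N1
    have "?B (3, 2) 0 v" for v
      by (simp add: N1 simple_refl_def weight_op_fundamental X2_T1)
    then show ?thesis using bernstein_quotient_fundamental(2) N1 by blast
  next
    case N2
    have "weight_op q (3, 1) v = X1_op q (X1_op q (X1_op q (X2_inv_op q v)))" for v
      by (simp add: weight_op_def int_iterate_def eval_nat_numeral)
    then have "?B (3, 2) (monoX (3, 2)) v" for v
      by (simp add: N2 simple_refl_def weight_op_fundamental algebra_act_monoX X2_T2)
    then show ?thesis using bernstein_quotient_fundamental(4) N2 by blast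
  qed
next
  case (add l m)
  then obtain f g where f: "bernstein_quotient i l f" "\<And>v. ?B l f v"
    and g: "bernstein_quotient i m g" "\<And>v. ?B m g v" by blast
  have "?B (l + m) (f * monoX (simple_refl i m) + monoX l * g) v" for v
    by (simp add: weights.act_plus f(2) g(2) simple_refl_add weights.act_add weights.act_scale
        weights.algebra_act_plus weights.algebra_act_times algebra_act_monoX
        scale6.scale_right_distrib)
  then show ?case using bernstein_quotient_add [OF f(1) g(1)] by blast
next
  case (uminus l)
  then obtain f where f: "bernstein_quotient i l f" "\<And>v. ?B l f v" by blast
  have "?B (- l) (- (monoX (- l) * f * monoX (- simple_refl i l))) v" for v
  proof -
    \<comment> \<open>Apply the relation for l to w = X^(- s l) v and multiply by X^(- l) from the left.\<close>
    let ?w = "weight_op q (- simple_refl i l) v"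
    have "T_op q i ?w = weight_op q (- l) (weight_op q l (T_op q i ?w))"
      by (simp add: weight_op_inverse)
    also have "\<dots> = weight_op q (- l) (T_op q i v)
        + scale6 (q - inverse q) (weight_op q (- l) (weights.algebra_act f ?w))"
      by (simp add: f(2) weight_op_inverse weights.act_add weights.act_scale)
    finally show ?thesis
      by (simp add: simple_refl_uminus weights.algebra_act_minus weights.algebra_act_times
          algebra_act_monoX scale6.scale_minus_right)
  qed
  then show ?case using bernstein_quotient_uminus [OF f(1)] by blast
qed

lemma bernstein_op:
  assumes "bernstein_quotient i l f"
  shows "weight_op q l (T_op q i v) =
         T_op q i (weight_op q (simple_refl i l) v)
         + scale6 (q - inverse q) (weights.algebra_act f v)"
  using bernstein_op_exists [of i l] bernstein_quotient_unique [OF assms] by blast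

lemma lift_group_alg_act:
  "words.algebra_act q (lift_group_alg f) v = weights.algebra_act f v"
proof -
  have *: "words.algebra_act q (\<Sum>l\<in>K. scal (c l) * genX l) v = (\<Sum>l\<in>K. scale6 (c l) (weight_op q l v))"
    if "finite K" for K c
    using that by induction
      (simp_all add: words.algebra_act_plus words.algebra_act_times single_act)
  show ?thesis
    by (simp add: lift_group_alg_def * weights.algebra_act_def linear_extension_def)
qed

lemma hecke_rels_act:
  assumes "x \<in> hecke_rels q" shows "words.algebra_act q x v = 0"
  using assms
proof cases
  case X_zero
  then show ?thesis by (simp add: words.algebra_act_diff single_act weights.act_zero)
next
  case (X_add l m)
  then show ?thesis
    by (simp add: words.algebra_act_diff words.algebra_act_times single_act weights.act_plus)
next
  case (quadratic i)
  then show ?thesis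
    by (simp add: words.algebra_act_diff words.algebra_act_plus words.algebra_act_times single_act
        T_quadratic)
next
  case braid
  then show ?thesis
    by (simp add: words.algebra_act_diff words.algebra_act_times single_act T_braid)
next
  case (bernstein f i l)
  then have "bernstein_quotient i l f" by (simp add: bernstein_quotient_def)
  from bernstein_op [OF this] show ?thesis
    by (simp add: bernstein words.algebra_act_diff words.algebra_act_plus words.algebra_act_times
        single_act lift_group_alg_act)
qed

lemma T1_e0: "T_op q N1 e0 = scale6 q e0"
  by (simp add: e0_def)

text \<open>The generator has weight t, where t(alpha1) = q^2 and t(alpha2) = 1.\<close>

lemma weight_op_e0: "weight_op q l e0 = scale6 (torus_point (q^2) 1 l) e0"
proof (induction l rule: weight_induct)
  case omega1
  then show ?case
    by (simp add: weight_op_fundamental e0_def torus_point_def reduce_q)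
next
  case omega2
  then show ?case
    by (simp add: weight_op_fundamental e0_def torus_point_def reduce_q)
next
  case (add l m)
  then show ?case
    by (simp add: weights.act_plus weights.act_scale torus_point_add q_nonzero mult.commute)
next
  case (uminus l)
  let ?t = "torus_point (q\<^sup>2) 1"
  have "e0 = weight_op q (- l) (scale6 (?t l) e0)" using uminus by (metis weight_op_inverse(1))
  then have "scale6 (inverse (?t l)) e0 =
      scale6 (inverse (?t l) * ?t l) (weight_op q (- l) e0)"
    by (simp add: weights.act_scale flip: scale6.scale_scale)
  then show ?case by (simp add: torus_point_uminus torus_point_nonzero q_nonzero)
qed

end

section \<open>Six words span the induced module\<close>

lemma scal_add: "scal (a + b) = scal a + scal b"
  by (simp add: scal_def single_add)

lemma scal_mult: "scal (a * b) = scal a * scal b"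
  by (simp add: scal_def mult_single)

lemma scal_uminus: "scal (- a) = - scal a"
  by (simp add: scal_def single_uminus)

lemma scal_0 [simp]: "scal 0 = 0" and scal_1 [simp]: "scal 1 = 1"
  by (simp_all add: scal_def)

lemma scal_commute: "x * scal a = scal a * x"
proof (induction x rule: poly_mapping_single_induct)
  case zero
  then show ?case by simp
next
  case (single_add k c x)
  then show ?case by (simp add: algebra_simps scal_def mult_single)
qed

lemma scal_left_commute: "x * (scal a * y) = scal a * (x * y)"
  by (metis mult.assoc scal_commute)

text \<open>Centrality of the scalars as a terminating rewrite system: scalars move to the left of the generators
  and are ordered among themselves.\<close>

lemmas scal_normalize =
  scal_commute [of "genT i" for i] scal_left_commute [of "genT i" for i]
  scal_commute [of "genX l" for l] scal_left_commute [of "genX l" for l]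
  scal_commute [of "scal a" for a] scal_left_commute [of "scal a" for a]

fun coset_word_sum :: "vec6 \<Rightarrow> free_alg" where
  "coset_word_sum (a0, a1, a2, a3, a4, a5) =
     scal a0
     + scal a1 * genT N2
     + scal a2 * (genT N1 * genT N2)
     + scal a3 * (genT N2 * (genT N1 * genT N2))
     + scal a4 * (genT N1 * (genT N2 * (genT N1 * genT N2)))
     + scal a5 * (genT N2 * (genT N1 * (genT N2 * (genT N1 * genT N2))))"

lemma coset_word_sum_add: "coset_word_sum (v + w) = coset_word_sum v + coset_word_sum w"
  by (cases v; cases w) (simp add: scal_add algebra_simps)

lemma coset_word_sum_scale: "coset_word_sum (scale6 z v) = scal z * coset_word_sum v"
  by (cases v) (simp add: scal_mult algebra_simps scal_normalize)

lemma coset_word_sum_act: "words.algebra_act q (coset_word_sum v) e0 = v"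
  by (cases v) (simp add: e0_def words.algebra_act_plus words.algebra_act_times single_act)

text \<open>The annihilator in the free algebra of a vector v of a module over the Hecke algebra with
  T1 v = q v and X^l v = t(l) v. Working modulo this left ideal is working with vectors h v.\<close>

locale character_left_ideal =
  fixes q :: complex and t :: "weight \<Rightarrow> complex" and J :: "free_alg set"
  assumes add: "x \<in> J \<Longrightarrow> y \<in> J \<Longrightarrow> x + y \<in> J"
    and mult: "x \<in> J \<Longrightarrow> y * x \<in> J"
    and rel: "r \<in> hecke_rels q \<Longrightarrow> r * y \<in> J"
    and T1: "genT N1 - scal q \<in> J"
    and X: "genX l - scal (t l) \<in> J"
begin

lemma zero: "0 \<in> J"
  using mult [OF T1, of 0] by simp

text \<open>On the span of the six vectors the operator of T_i is given by its matrix. Columns in which T_i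
  extends a word need no relation; those in which it shortens one need a quadratic relation, and
  the columns in which T1 acts by q need the eigenvector relation for v and, for e5, the braid
  relation.\<close>

lemma genT_coset_word_sum: "genT i * coset_word_sum v - coset_word_sum (T_op q i v) \<in> J"
proof -
  define c where "c = q - inverse q"
  let ?a = "genT N1" and ?b = "genT N2"
  have quad: "(genT i * genT i - (scal c * genT i + 1)) * x \<in> J" for i x
    unfolding c_def by (intro rel quadratic)
  have br: "?a * ?b * ?a * ?b * ?a * ?b - ?b * ?a * ?b * ?a * ?b * ?a \<in> J"
    using rel [OF braid, of 1] by simp
  obtain a0 a1 a2 a3 a4 a5 where v: "v = (a0, a1, a2, a3, a4, a5)" by (cases v)
  show ?thesis
  proof (cases i)
    case N1
    have "genT i * coset_word_sum v - coset_word_sum (T_op q i v) =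
      scal a0 * (?a - scal q)
      + scal a2 * ((?a * ?a - (scal c * ?a + 1)) * ?b)
      + scal a4 * ((?a * ?a - (scal c * ?a + 1)) * (?b * (?a * ?b)))
      + scal a5 * (?a * ?b * ?a * ?b * ?a * ?b - ?b * ?a * ?b * ?a * ?b * ?a)
      + scal a5 * (?b * ?a * ?b * ?a * ?b * (?a - scal q))"
      by (simp add: N1 v algebra_simps scal_add scal_mult flip: c_def)
        (simp add: scal_normalize)
    then show ?thesis
      by (simp add: add mult T1 quad br)
  next
    case N2
    have "genT i * coset_word_sum v - coset_word_sum (T_op q i v) =
      scal a1 * ((?b * ?b - (scal c * ?b + 1)) * 1)
      + scal a3 * ((?b * ?b - (scal c * ?b + 1)) * (?a * ?b))
      + scal a5 * ((?b * ?b - (scal c * ?b + 1)) * (?a * (?b * (?a * ?b))))"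
      by (simp add: N2 v algebra_simps scal_add scal_mult flip: c_def)
        (simp add: scal_normalize)
    then show ?thesis
      by (simp only: add mult quad)
  qed
qed

definition spanned :: "free_alg set" where
  "spanned = {x. \<exists>v. x - coset_word_sum v \<in> J}"

lemma spannedI: "x - coset_word_sum v \<in> J \<Longrightarrow> x \<in> spanned"
  unfolding spanned_def by blast

lemma spannedE:
  assumes "x \<in> spanned" obtains v where "x - coset_word_sum v \<in> J"
  using assms unfolding spanned_def by blast

lemma spanned_add: "x + y \<in> spanned" if xy: "x \<in> spanned" "y \<in> spanned"
proof -
  obtain v w where "x - coset_word_sum v \<in> J" "y - coset_word_sum w \<in> J"
    using xy by (elim spannedE)
  then have "(x - coset_word_sum v) + (y - coset_word_sum w) \<in> J" by (rule add)
  then show ?thesis by (intro spannedI [of _ "v + w"]) (simp add: coset_word_sum_add algebra_simps)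
qed

lemma spanned_scal: "scal a * x \<in> spanned" if x: "x \<in> spanned"
proof -
  obtain v where "x - coset_word_sum v \<in> J" using x by (rule spannedE)
  then have "scal a * (x - coset_word_sum v) \<in> J" by (rule mult)
  then show ?thesis
    by (intro spannedI [of _ "scale6 a v"]) (simp add: coset_word_sum_scale algebra_simps)
qed

lemma spanned_zero: "0 \<in> spanned"
  by (rule spannedI [of _ 0]) (simp add: zero zero_prod_def)

lemma spanned_sum: "(\<And>k. k \<in> K \<Longrightarrow> x k \<in> spanned) \<Longrightarrow> (\<Sum>k\<in>K. x k) \<in> spanned"
  by (induction K rule: infinite_finite_induct) (auto intro: spanned_zero spanned_add)

lemma spanned_cong: "y \<in> spanned" if x: "x \<in> spanned" and xy: "y - x \<in> J"
proof -
  obtain v where "x - coset_word_sum v \<in> J" using x by (rule spannedE)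
  from add [OF this xy] show ?thesis by (intro spannedI [of _ v]) simp
qed

lemma spanned_genT: "genT i * x \<in> spanned" if x: "x \<in> spanned"
proof -
  obtain v where "x - coset_word_sum v \<in> J" using x by (rule spannedE)
  then have "genT i * (x - coset_word_sum v) \<in> J" by (rule mult)
  from add [OF this genT_coset_word_sum [of i v]] show ?thesis
    by (intro spannedI [of _ "T_op q i v"]) (simp add: algebra_simps)
qed

text \<open>Moving X^l past T_i produces only terms in which some X^m stands directly in front of y, so
  if all of C[X] maps y into the span, the same is true of T_i y.\<close>

lemma spanned_genX_genT: "genX l * (genT i * y) \<in> spanned"
  if y: "\<And>l. genX l * y \<in> spanned"
proof -
  obtain f where "bernstein_quotient i l f" using bernstein_quotient_exists by blast
  then have "(genX l * genT i
    - (genT i * genX (simple_refl i l) + scal (q - inverse q) * lift_group_alg f)) * y \<in> J"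
    by (intro rel bernstein) (simp add: bernstein_quotient_def)
  then have *: "genX l * (genT i * y)
    - (genT i * (genX (simple_refl i l) * y) + scal (q - inverse q) * (lift_group_alg f * y)) \<in> J"
    by (simp add: algebra_simps)
  have "lift_group_alg f * y \<in> spanned"
    by (simp add: lift_group_alg_def sum_distrib_right mult.assoc)
      (intro spanned_sum spanned_scal y)
  then have "genT i * (genX (simple_refl i l) * y)
    + scal (q - inverse q) * (lift_group_alg f * y) \<in> spanned"
    by (intro spanned_add spanned_genT spanned_scal y)
  then show ?thesis using * by (rule spanned_cong)
qed

lemma spanned_genX: "genX l * x \<in> spanned" if x: "x \<in> spanned"
proof -
  obtain v where v: "x - coset_word_sum v \<in> J" using x by (rule spannedE)
  have one: "genX l * 1 \<in> spanned" for l
    by (rule spannedI [of _ "scale6 (t l) e0"]) (simp add: e0_def X)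
  have b: "genX l * genT N2 \<in> spanned" for l
    using spanned_genX_genT [OF one, of l N2] by simp
  have "genX l * coset_word_sum v \<in> spanned"
    using one [of l]
    by (cases v)
      (auto simp: distrib_left scal_normalize
        intro!: spanned_add spanned_scal spanned_genX_genT b)
  moreover have "genX l * x - genX l * coset_word_sum v \<in> J"
    using mult [OF v, of "genX l"] by (simp add: algebra_simps)
  ultimately show ?thesis by (rule spanned_cong)
qed

lemma all_spanned: "x \<in> spanned"
proof -
  have word: "Poly_Mapping.single (Word gs) 1 \<in> spanned" for gs
  proof (induction gs)
    case Nil
    have "Poly_Mapping.single (Word []) 1 = (1 :: free_alg)"
      by (simp flip: zero_free_monoid_def)
    then show ?case
      using zero by (intro spannedI [of _ e0]) (simp add: e0_def)
  next
    case (Cons g gs)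
    have "Poly_Mapping.single (Word (g # gs)) (1::complex) =
      Poly_Mapping.single (Word [g]) 1 * Poly_Mapping.single (Word gs) 1"
      by (simp add: mult_single plus_free_monoid_def)
    then show ?case
      using spanned_genT [OF Cons] spanned_genX [OF Cons]
      by (cases g) (simp_all add: genT_def genX_def)
  qed
  show ?thesis
  proof (induction x rule: poly_mapping_single_induct)
    case zero
    show ?case by (rule spanned_zero)
  next
    case (single_add w c x)
    have "scal c * Poly_Mapping.single (Word (letters w)) 1 = Poly_Mapping.single w c"
      by (simp add: scal_def mult_single)
    then show ?case
      using spanned_add [OF spanned_scal [OF word] single_add] by metis
  qed
qed

text \<open>The six words are sent to the six basis vectors of the representation. So once the
  annihilator of v also annihilates e0, the words are independent modulo it and nothing else can
  annihilate e0.\<close>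

lemma eq_annihilator:
  assumes "\<And>x. x \<in> J \<Longrightarrow> words.algebra_act q x e0 = 0"
  shows "x \<in> J \<longleftrightarrow> words.algebra_act q x e0 = 0"
proof
  assume x: "words.algebra_act q x e0 = 0"
  obtain v where v: "x - coset_word_sum v \<in> J" using all_spanned [of x] by (rule spannedE)
  have "v = 0"
    using assms [OF v] x by (simp add: words.algebra_act_diff coset_word_sum_act)
  then show "x \<in> J" using v by (simp add: zero_prod_def)
qed (rule assms)

end

section \<open>Every nonzero vector generates the representation\<close>

context cubic_parameter
begin

fun coord5 :: "vec6 \<Rightarrow> complex" where "coord5 (a0, a1, a2, a3, a4, a5) = a5"

text \<open>X^omega2 is unipotent, and its matrix minus the identity, which is strictly upper
  triangular, has a square with a single nonzero entry, in the corner.\<close>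

lemma rank_one:
  "words.algebra_act q ((genX (3, 2) - 1) * (genX (3, 2) - 1)) v = scale6 (- 9 * q ^ 3 * coord5 v) e0"
proof -
  have "words.algebra_act q ((genX (3, 2) - 1) * (genX (3, 2) - 1)) v =
      X2_op q (X2_op q v - v) - (X2_op q v - v)"
    by (simp only: words.algebra_act_times words.algebra_act_diff words.algebra_act_1 single_act
        weight_op_fundamental)
  also have "\<dots> = scale6 (- 9 * q ^ 3 * coord5 v) e0"
    by (cases v) (simp add: e0_def zero_prod_def reduce_q)
  finally show ?thesis .
qed

text \<open>If a_k is the last nonzero coordinate, then the product of 5 - k alternating factors ending on the
  left in T2 moves e_k to e5 and keeps the contributions of e0, ..., e_(k-1) off e5.\<close>

lemma coord5_nonzero:
  assumes "v \<noteq> 0" shows "\<exists>h. coord5 (words.algebra_act q h v) \<noteq> 0"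
proof -
  obtain a0 a1 a2 a3 a4 a5 where v: "v = (a0, a1, a2, a3, a4, a5)" by (cases v)
  let ?a = "genT N1" and ?b = "genT N2"
  note s = v words.algebra_act_times single_act
  consider "a5 \<noteq> 0" | "a5 = 0" "a4 \<noteq> 0" | "a5 = 0" "a4 = 0" "a3 \<noteq> 0"
    | "a5 = 0" "a4 = 0" "a3 = 0" "a2 \<noteq> 0" | "a5 = 0" "a4 = 0" "a3 = 0" "a2 = 0" "a1 \<noteq> 0"
    | "a5 = 0" "a4 = 0" "a3 = 0" "a2 = 0" "a1 = 0" "a0 \<noteq> 0"
    using assms by (auto simp: v zero_prod_def)
  then show ?thesis
  proof cases
    case 1
    then show ?thesis by (intro exI [of _ 1]) (simp add: s)
  next
    case 2
    then show ?thesis by (intro exI [of _ ?b]) (simp add: s)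
  next
    case 3
    then show ?thesis by (intro exI [of _ "?b * ?a"]) (simp add: s)
  next
    case 4
    then show ?thesis by (intro exI [of _ "?b * ?a * ?b"]) (simp add: s)
  next
    case 5
    then show ?thesis by (intro exI [of _ "?b * ?a * ?b * ?a"]) (simp add: s)
  next
    case 6
    then show ?thesis by (intro exI [of _ "?b * ?a * ?b * ?a * ?b"]) (simp add: s)
  qed
qed

lemma generates_e0:
  assumes "v \<noteq> 0" shows "\<exists>h. words.algebra_act q h v = e0"
proof -
  obtain h where h: "coord5 (words.algebra_act q h v) \<noteq> 0" using coord5_nonzero [OF assms] ..
  define z where "z = - 9 * q ^ 3 * coord5 (words.algebra_act q h v)"
  have "z \<noteq> 0" using h q_nonzero by (simp add: z_def)
  have "words.algebra_act q
      (scal (inverse z) * (((genX (3, 2) - 1) * (genX (3, 2) - 1)) * h)) v =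
      scale6 (inverse z) (scale6 z e0)"
    unfolding z_def
    by (simp only: words.algebra_act_times [of _ "scal _"] words.algebra_act_times [of _ _ h]
        single_act rank_one)
  also have "\<dots> = e0" using \<open>z \<noteq> 0\<close> by simp
  finally have "words.algebra_act q
      (scal (inverse z) * (((genX (3, 2) - 1) * (genX (3, 2) - 1)) * h)) v = e0" .
  then show ?thesis ..
qed

end

section \<open>Modules induced along a subring\<close>

locale tensor_data = R?: ring R
  for R :: "('r, 'm) ring_scheme" (structure)
    and S :: "('r, 'n) ring_scheme" and V :: "('r, 'v, 'k) module_scheme" +
  assumes S_subset: "carrier S \<subseteq> carrier R"
    and V_add_closed: "\<lbrakk>v \<in> carrier V; w \<in> carrier V\<rbrakk> \<Longrightarrow> v \<oplus>\<^bsub>V\<^esub> w \<in> carrier V"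
    and V_smult_closed: "\<lbrakk>s \<in> carrier S; v \<in> carrier V\<rbrakk> \<Longrightarrow> s \<odot>\<^bsub>V\<^esub> v \<in> carrier V"
begin

abbreviation F :: "('r \<times> 'v \<Rightarrow>\<^sub>0 int) monoid" where
  "F \<equiv> free_Abelian_group (carrier R \<times> carrier V)"

abbreviation relations :: "('r \<times> 'v \<Rightarrow>\<^sub>0 int) set" where
  "relations \<equiv> generate F (tensor_rels R S V)"

text \<open>The class of a formal sum of pure tensors in the tensor product.\<close>

definition cls :: "('r \<times> 'v \<Rightarrow>\<^sub>0 int) \<Rightarrow> ('r \<times> 'v \<Rightarrow>\<^sub>0 int) set" where
  "cls x = relations #>\<^bsub>F\<^esub> x"

abbreviation Ind :: "('r, ('r \<times> 'v \<Rightarrow>\<^sub>0 int) set) module" where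
  "Ind \<equiv> induced_module R S V"

lemma cls_eq_image: "cls x = (\<lambda>h. h + x) ` relations"
  by (auto simp: cls_def r_coset_def)

lemma F_diff: "\<lbrakk>x \<in> carrier F; y \<in> carrier F\<rbrakk> \<Longrightarrow> x - y \<in> carrier F"
  using keys_diff [of x y] by auto

lemma F_add: "\<lbrakk>x \<in> carrier F; y \<in> carrier F\<rbrakk> \<Longrightarrow> x + y \<in> carrier F"
  using Poly_Mapping.keys_add [of x y] by auto

lemma frag_of_F: "\<lbrakk>a \<in> carrier R; v \<in> carrier V\<rbrakk> \<Longrightarrow> frag_of (a, v) \<in> carrier F"
  by simp

lemma F_zero: "0 \<in> carrier F"
  by simp

lemma tensor_rels_add_left:
  "\<lbrakk>a \<in> carrier R; b \<in> carrier R; v \<in> carrier V\<rbrakk> \<Longrightarrow>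
   frag_of (a \<oplus> b, v) - (frag_of (a, v) + frag_of (b, v)) \<in> tensor_rels R S V"
  unfolding tensor_rels_def
  by (rule UnI1, rule UnI1, rule CollectI, intro exI conjI, rule refl) assumption+

lemma tensor_rels_add_right:
  "\<lbrakk>a \<in> carrier R; v \<in> carrier V; w \<in> carrier V\<rbrakk> \<Longrightarrow>
   frag_of (a, v \<oplus>\<^bsub>V\<^esub> w) - (frag_of (a, v) + frag_of (a, w)) \<in> tensor_rels R S V"
  unfolding tensor_rels_def
  by (rule UnI1, rule UnI2, rule CollectI, intro exI conjI, rule refl) assumption+

lemma tensor_rels_balanced:
  "\<lbrakk>a \<in> carrier R; s \<in> carrier S; v \<in> carrier V\<rbrakk> \<Longrightarrow>
   frag_of (a \<otimes> s, v) - frag_of (a, s \<odot>\<^bsub>V\<^esub> v) \<in> tensor_rels R S V"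
  unfolding tensor_rels_def
  by (rule UnI2, rule CollectI, intro exI conjI, rule refl) assumption+

lemma tensor_rels_cases:
  assumes "x \<in> tensor_rels R S V"
  obtains (add_left) a b v where "a \<in> carrier R" "b \<in> carrier R" "v \<in> carrier V"
      "x = frag_of (a \<oplus> b, v) - (frag_of (a, v) + frag_of (b, v))"
    | (add_right) a v w where "a \<in> carrier R" "v \<in> carrier V" "w \<in> carrier V"
      "x = frag_of (a, v \<oplus>\<^bsub>V\<^esub> w) - (frag_of (a, v) + frag_of (a, w))"
    | (balanced) a s v where "a \<in> carrier R" "s \<in> carrier S" "v \<in> carrier V"
      "x = frag_of (a \<otimes> s, v) - frag_of (a, s \<odot>\<^bsub>V\<^esub> v)"
  using assms unfolding tensor_rels_def by (elim UnE CollectE exE conjE)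
    (rule add_left add_right balanced, assumption, assumption, assumption, assumption)+

lemma tensor_rels_subset: "tensor_rels R S V \<subseteq> carrier F"
  unfolding tensor_rels_def
  by (intro Un_least; clarify; intro F_diff F_add frag_of_F)
    (auto simp: V_add_closed V_smult_closed S_subset [THEN subsetD])

lemma relations_subset: "relations \<subseteq> carrier F"
  by (intro group.generate_incl group_free_Abelian_group tensor_rels_subset)

lemma relations_zero: "0 \<in> relations"
  using generate.one [of F] by simp

lemma relations_add: "x \<in> relations \<Longrightarrow> y \<in> relations \<Longrightarrow> x + y \<in> relations"
  using generate.eng [of x F] by simp

lemma relations_uminus: "x \<in> relations \<Longrightarrow> - x \<in> relations"
  using group.generate_m_inv_closed [OF group_free_Abelian_group tensor_rels_subset, of x]
    relations_subset by (auto simp: inv_free_Abelian_group)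

lemma relations_diff: "x \<in> relations \<Longrightarrow> y \<in> relations \<Longrightarrow> x - y \<in> relations"
  using relations_add [of x "- y"] relations_uminus by simp

text \<open>Closure under differences is the only closure property needed, since a subgroup is
  closed under 0 - y and x - (0 - y).\<close>

lemma relations_induct [consumes 1, case_names zero rel diff]:
  assumes "x \<in> relations" "P 0" "\<And>x. x \<in> tensor_rels R S V \<Longrightarrow> P x"
    and diff: "\<And>x y. P x \<Longrightarrow> P y \<Longrightarrow> P (x - y)"
  shows "P x"
  using assms(1)
proof induction
  case (inv h)
  have "P (0 - h)" using assms inv by blast
  then show ?case using tensor_rels_subset inv by (auto simp: subset_iff)
next
  case (eng x y)
  have "P (x - (0 - y))" using eng assms by blast
  then show ?case by simp
qed (use assms in simp_all)

lemma cls_eq_iff: "cls x = cls y \<longleftrightarrow> x - y \<in> relations"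
proof
  assume "cls x = cls y"
  then have "0 + x \<in> cls y" using relations_zero by (force simp: cls_eq_image)
  then show "x - y \<in> relations" by (auto simp: cls_eq_image)
next
  assume xy: "x - y \<in> relations"
  have "cls u \<subseteq> cls w" if "u - w \<in> relations" for u w
  proof
    fix z assume "z \<in> cls u"
    then obtain h where h: "h \<in> relations" "z = h + u" by (auto simp: cls_eq_image)
    have "z = (h + (u - w)) + w" by (simp add: h)
    then show "z \<in> cls w" using relations_add [OF h(1) that] by (simp only: cls_eq_image image_eqI)
  qed
  from this [OF xy] this [of y x] relations_uminus [OF xy] show "cls x = cls y" by auto
qed

lemma cls_zero: "cls 0 = relations"
  by (simp add: cls_eq_image)

lemma set_mult_memI: "a \<in> A \<Longrightarrow> b \<in> B \<Longrightarrow> a + b \<in> A <#>\<^bsub>F\<^esub> B"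
  by (auto simp: set_mult_def)

lemma cls_set_mult: "cls x <#>\<^bsub>F\<^esub> cls y = cls (x + y)"
proof
  show "cls x <#>\<^bsub>F\<^esub> cls y \<subseteq> cls (x + y)"
  proof
    fix z assume "z \<in> cls x <#>\<^bsub>F\<^esub> cls y"
    then obtain h k where hk: "h \<in> relations" "k \<in> relations" "z = (h + x) + (k + y)"
      by (auto simp: cls_eq_image set_mult_def)
    have "z = (h + k) + (x + y)" by (simp add: hk)
    then show "z \<in> cls (x + y)" using relations_add [OF hk(1,2)]
      by (simp only: cls_eq_image image_eqI)
  qed
  show "cls (x + y) \<subseteq> cls x <#>\<^bsub>F\<^esub> cls y"
  proof
    fix z assume "z \<in> cls (x + y)"
    then obtain h where h: "h \<in> relations" "z = h + (x + y)" by (auto simp: cls_eq_image)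
    have "(h + x) + (0 + y) \<in> cls x <#>\<^bsub>F\<^esub> cls y"
      using h(1) relations_zero unfolding cls_eq_image by (intro set_mult_memI imageI)
    then show "z \<in> cls x <#>\<^bsub>F\<^esub> cls y" by (simp add: h add.assoc)
  qed
qed

lemma carrier_Ind: "carrier Ind = cls ` carrier F"
  unfolding induced_module_def tensor_group_def Let_def
  by (simp add: carrier_FactGroup cls_def [abs_def])

lemma cls_in_carrier: "x \<in> carrier F \<Longrightarrow> cls x \<in> carrier Ind"
  by (simp add: carrier_Ind)

lemma zero_Ind: "\<zero>\<^bsub>Ind\<^esub> = cls 0"
  by (simp add: induced_module_def tensor_group_def Let_def cls_zero)

lemma add_Ind: "cls x \<oplus>\<^bsub>Ind\<^esub> cls y = cls (x + y)"
  by (simp add: induced_module_def tensor_group_def Let_def cls_set_mult)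

lemma left_mult_frag_of [simp]: "left_mult R a (frag_of (b, v)) = frag_of (a \<otimes> b, v)"
  by (simp add: left_mult_def)

lemma left_mult_add: "left_mult R a (x + y) = left_mult R a x + left_mult R a y"
  by (simp add: left_mult_def frag_extend_add)

lemma left_mult_diff: "left_mult R a (x - y) = left_mult R a x - left_mult R a y"
  by (simp add: left_mult_def frag_extend_diff)

lemma left_mult_zero [simp]: "left_mult R a 0 = 0"
  by (simp add: left_mult_def)

lemma F_induct [consumes 1, case_names zero diff frag_of]:
  assumes "x \<in> carrier F" "P 0"
    and "\<And>x y. \<lbrakk>x \<in> carrier F; y \<in> carrier F; P x; P y\<rbrakk> \<Longrightarrow> P (x - y)"
    and "\<And>a v. \<lbrakk>a \<in> carrier R; v \<in> carrier V\<rbrakk> \<Longrightarrow> P (frag_of (a, v))"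
  shows "P x"
  using assms by (intro free_Abelian_group_induct [of x "carrier R \<times> carrier V" P]) auto

lemma left_mult_closed:
  assumes "a \<in> carrier R" "x \<in> carrier F" shows "left_mult R a x \<in> carrier F"
  using assms(2)
proof (induction rule: F_induct)
  case (diff x y)
  then show ?case by (simp only: left_mult_diff F_diff)
next
  case (frag_of b v)
  then show ?case using assms(1) by simp
qed simp

text \<open>Left multiplication maps each of the three kinds of relation to one of the same kind; this is
  what makes the action on the tensor product well defined.\<close>

lemma left_mult_relations:
  assumes a: "a \<in> carrier R" and "x \<in> relations" shows "left_mult R a x \<in> relations"
  using assms(2)
proof (induction rule: relations_induct)
  case zero
  then show ?case by (simp add: relations_zero)
next
  case (diff x y)
  then show ?case by (simp add: left_mult_diff relations_diff)
next
  case (rel x)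
  have "left_mult R a x \<in> tensor_rels R S V"
    using rel
  proof (cases rule: tensor_rels_cases)
    case (add_left b c v)
    then show ?thesis
      using a tensor_rels_add_left [of "a \<otimes> b" "a \<otimes> c" v]
      by (simp add: left_mult_diff left_mult_add r_distr)
  next
    case (add_right b v w)
    then show ?thesis
      using a tensor_rels_add_right [of "a \<otimes> b" v w]
      by (simp add: left_mult_diff left_mult_add)
  next
    case (balanced b s v)
    then show ?thesis
      using a S_subset tensor_rels_balanced [of "a \<otimes> b" s v]
      by (simp add: left_mult_diff m_assoc subset_iff)
  qed
  then show ?case by (rule generate.incl)
qed

lemma smult_Ind:
  assumes a: "a \<in> carrier R" shows "a \<odot>\<^bsub>Ind\<^esub> cls x = cls (left_mult R a x)"
proof -
  have "a \<odot>\<^bsub>Ind\<^esub> cls x = relations <#>\<^bsub>F\<^esub> (left_mult R a ` cls x)"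
    by (simp add: induced_module_def tensor_group_def Let_def)
  also have "\<dots> = cls (left_mult R a x)"
  proof
    show "relations <#>\<^bsub>F\<^esub> (left_mult R a ` cls x) \<subseteq> cls (left_mult R a x)"
    proof
      fix z assume "z \<in> relations <#>\<^bsub>F\<^esub> (left_mult R a ` cls x)"
      then obtain h k where hk: "h \<in> relations" "k \<in> relations" "z = h + left_mult R a (k + x)"
        by (auto simp: cls_eq_image set_mult_def)
      have "z = (h + left_mult R a k) + left_mult R a x" by (simp add: hk left_mult_add)
      then show "z \<in> cls (left_mult R a x)"
        using relations_add [OF hk(1) left_mult_relations [OF a hk(2)]]
        by (simp only: cls_eq_image image_eqI)
    qed
    show "cls (left_mult R a x) \<subseteq> relations <#>\<^bsub>F\<^esub> (left_mult R a ` cls x)"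
    proof
      fix z assume "z \<in> cls (left_mult R a x)"
      then obtain h where h: "h \<in> relations" "z = h + left_mult R a x"
        by (auto simp: cls_eq_image)
      have "h + left_mult R a (0 + x) \<in> relations <#>\<^bsub>F\<^esub> (left_mult R a ` cls x)"
        using h(1) relations_zero unfolding cls_eq_image by (intro set_mult_memI imageI)
      then show "z \<in> relations <#>\<^bsub>F\<^esub> (left_mult R a ` cls x)" by (simp add: h)
    qed
  qed
  finally show ?thesis .
qed

lemma cls_left_mult_l_distr:
  assumes "a \<in> carrier R" "b \<in> carrier R" "x \<in> carrier F"
  shows "left_mult R (a \<oplus> b) x - (left_mult R a x + left_mult R b x) \<in> relations"
  using assms(3)
proof (induction rule: F_induct)
  case zero
  then show ?case by (simp add: relations_zero)
next
  case (diff x y)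
  from relations_diff [OF diff(3,4)] show ?case
    by (simp add: left_mult_diff algebra_simps)
next
  case (frag_of c v)
  have "frag_of (a \<otimes> c \<oplus> b \<otimes> c, v) - (frag_of (a \<otimes> c, v) + frag_of (b \<otimes> c, v)) \<in> tensor_rels R S V"
    using assms frag_of by (intro tensor_rels_add_left) simp_all
  then show ?case using assms frag_of by (simp add: l_distr generate.incl)
qed

lemma left_mult_assoc:
  assumes "a \<in> carrier R" "b \<in> carrier R" "x \<in> carrier F"
  shows "left_mult R (a \<otimes> b) x = left_mult R a (left_mult R b x)"
  using assms(3)
proof (induction rule: F_induct)
  case (diff x y)
  then show ?case by (simp only: left_mult_diff)
next
  case (frag_of c v)
  then show ?case using assms by (simp add: m_assoc)
qed simp

lemma left_mult_one:
  assumes "x \<in> carrier F" shows "left_mult R \<one> x = x"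
  using assms
proof (induction rule: F_induct)
  case (diff x y)
  then show ?case by (simp only: left_mult_diff)
qed simp_all

lemma left_module_Ind: "left_module R Ind"
proof (intro left_module.intro left_module_axioms.intro)
  show "ring R" by (rule ring_axioms)
  show "abelian_group Ind"
  proof (rule abelian_groupI)
    fix x assume "x \<in> carrier Ind"
    then obtain u where u: "u \<in> carrier F" "x = cls u" by (auto simp: carrier_Ind)
    then show "\<exists>y\<in>carrier Ind. y \<oplus>\<^bsub>Ind\<^esub> x = \<zero>\<^bsub>Ind\<^esub>"
      using F_diff [of 0 u] by (intro bexI [of _ "cls (- u)"]) (auto simp: add_Ind zero_Ind cls_in_carrier)
  next
    fix x y z assume "x \<in> carrier Ind" "y \<in> carrier Ind" "z \<in> carrier Ind"
    then show "x \<oplus>\<^bsub>Ind\<^esub> y \<oplus>\<^bsub>Ind\<^esub> z = x \<oplus>\<^bsub>Ind\<^esub> (y \<oplus>\<^bsub>Ind\<^esub> z)"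
      by (auto simp: carrier_Ind add_Ind add.assoc simp del: carrier_free_Abelian_group_iff)
  next
    fix x y assume "x \<in> carrier Ind" "y \<in> carrier Ind"
    then show "x \<oplus>\<^bsub>Ind\<^esub> y = y \<oplus>\<^bsub>Ind\<^esub> x"
      by (auto simp: carrier_Ind add_Ind add.commute simp del: carrier_free_Abelian_group_iff)
  qed (use F_zero in \<open>auto simp: carrier_Ind add_Ind zero_Ind
      simp del: carrier_free_Abelian_group_iff intro!: imageI F_add\<close>)
next
  fix a b x assume *: "a \<in> carrier R" "b \<in> carrier R" "x \<in> carrier Ind"
  then obtain u where "u \<in> carrier F" "x = cls u" by (auto simp: carrier_Ind)
  moreover have "cls (left_mult R (a \<oplus> b) u) = cls (left_mult R a u + left_mult R b u)"
    using * calculation by (simp only: cls_eq_iff cls_left_mult_l_distr)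
  ultimately show "(a \<oplus> b) \<odot>\<^bsub>Ind\<^esub> x = a \<odot>\<^bsub>Ind\<^esub> x \<oplus>\<^bsub>Ind\<^esub> b \<odot>\<^bsub>Ind\<^esub> x"
    using * by (simp add: smult_Ind add_Ind)
qed (auto simp: carrier_Ind smult_Ind add_Ind left_mult_closed left_mult_add left_mult_assoc
    left_mult_one simp del: carrier_free_Abelian_group_iff)

end

section \<open>The Hecke algebra as a quotient\<close>

lemma ring_free_algebra: "ring free_algebra"
proof -
  have "\<exists>y. y + x = 0" for x :: free_alg by (rule exI [of _ "- x"]) simp
  then show ?thesis
    by (intro ringI abelian_groupI monoidI) (auto simp: free_algebra_def algebra_simps)
qed

lemma free_algebra_simps [simp]:
  "carrier free_algebra = UNIV" "x \<otimes>\<^bsub>free_algebra\<^esub> y = x * y" "x \<oplus>\<^bsub>free_algebra\<^esub> y = x + y"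
  "\<one>\<^bsub>free_algebra\<^esub> = 1" "\<zero>\<^bsub>free_algebra\<^esub> = 0"
  by (simp_all add: free_algebra_def)

lemma hecke_ideal: "ideal (Idl\<^bsub>free_algebra\<^esub> (hecke_rels q)) free_algebra"
  by (rule ring.genideal_ideal [OF ring_free_algebra]) simp

lemma ring_hecke: "ring (hecke q)"
  unfolding hecke_def by (rule ideal.quotient_is_ring [OF hecke_ideal])

lemma hecke_of_hom: "hecke_of q \<in> ring_hom free_algebra (hecke q)"
  using ideal.rcos_ring_hom [OF hecke_ideal] by (simp add: hecke_of_def [abs_def] hecke_def)

lemma hecke_of_closed: "hecke_of q x \<in> carrier (hecke q)"
  using ring_hom_closed [OF hecke_of_hom] by simp

lemma hecke_of_add: "hecke_of q (x + y) = hecke_of q x \<oplus>\<^bsub>hecke q\<^esub> hecke_of q y"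
  using ring_hom_add [OF hecke_of_hom, of x y] by simp

lemma hecke_of_mult: "hecke_of q (x * y) = hecke_of q x \<otimes>\<^bsub>hecke q\<^esub> hecke_of q y"
  using ring_hom_mult [OF hecke_of_hom, of x y] by simp

lemma hecke_of_1: "hecke_of q 1 = \<one>\<^bsub>hecke q\<^esub>"
  using ring_hom_one [OF hecke_of_hom] by simp

lemma hecke_of_0: "hecke_of q 0 = \<zero>\<^bsub>hecke q\<^esub>"
  using ring_hom_zero [OF hecke_of_hom ring_free_algebra ring_hecke] by simp

lemma hecke_of_uminus: "\<ominus>\<^bsub>hecke q\<^esub> hecke_of q x = hecke_of q (- x)"
proof -
  interpret H: ring "hecke q" by (rule ring_hecke)
  have "hecke_of q (- x) \<oplus>\<^bsub>hecke q\<^esub> hecke_of q x = \<zero>\<^bsub>hecke q\<^esub>"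
    by (simp flip: hecke_of_add hecke_of_0)
  then show ?thesis by (rule H.minus_equality) (rule hecke_of_closed)+
qed

lemma hecke_of_surj:
  assumes "C \<in> carrier (hecke q)" obtains x where "C = hecke_of q x"
  using assms by (auto simp: hecke_def hecke_of_def FactRing_def A_RCOSETS_def')

lemma hecke_of_eqD:
  assumes "hecke_of q x = hecke_of q y" shows "x - y \<in> Idl\<^bsub>free_algebra\<^esub> (hecke_rels q)"
proof -
  let ?I = "Idl\<^bsub>free_algebra\<^esub> (hecke_rels q)"
  interpret ideal ?I free_algebra by (rule hecke_ideal)
  have "x \<in> ?I +>\<^bsub>free_algebra\<^esub> y"
    using assms a_rcos_self [of x] by (simp add: hecke_of_def)
  then show ?thesis by (auto simp: a_r_coset_def r_coset_def)
qed

lemma hecke_of_rel: "r \<in> hecke_rels q \<Longrightarrow> hecke_of q r = \<zero>\<^bsub>hecke q\<^esub>"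
proof -
  let ?I = "Idl\<^bsub>free_algebra\<^esub> (hecke_rels q)"
  interpret ideal ?I free_algebra by (rule hecke_ideal)
  assume "r \<in> hecke_rels q"
  then have "r \<in> ?I" using genideal_self [of "hecke_rels q"] by auto
  then show ?thesis
    by (simp add: hecke_of_def hecke_def FactRing_def a_rcos_const)
qed

lemma hecke_of_genX_0: "hecke_of q (genX 0) = \<one>\<^bsub>hecke q\<^esub>"
proof -
  interpret H: ring "hecke q" by (rule ring_hecke)
  have "hecke_of q (genX 0) = hecke_of q (genX 0 - 1) \<oplus>\<^bsub>hecke q\<^esub> hecke_of q 1"
    by (simp flip: hecke_of_add)
  then show ?thesis
    using hecke_of_rel [OF X_zero] by (simp add: hecke_of_1)
qed

lemma lift_group_alg_single: "lift_group_alg (Poly_Mapping.single l c) = scal c * genX l"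
proof -
  have "lift_group_alg f = linear_extension (\<lambda>c x. scal c * x) genX f" for f
    by (simp add: lift_group_alg_def linear_extension_def)
  then show ?thesis by (simp add: linear_extension_single)
qed

lemma lift_group_alg_add: "lift_group_alg (f + g) = lift_group_alg f + lift_group_alg g"
proof -
  have "lift_group_alg f = linear_extension (\<lambda>c x. scal c * x) genX f" for f
    by (simp add: lift_group_alg_def linear_extension_def)
  then show ?thesis by (simp add: linear_extension_add scal_add distrib_right)
qed

definition parabolic_generators :: "complex \<Rightarrow> node \<Rightarrow> free_alg set set" where
  "parabolic_generators q i =
     insert (hecke_of q (genT i)) (range (\<lambda>f. hecke_of q (lift_group_alg f)))"

lemma parabolic_generators_subset: "parabolic_generators q i \<subseteq> carrier (hecke q)"
  by (auto simp: parabolic_generators_def hecke_of_closed)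

lemma carrier_parabolic:
  "carrier (hecke_parabolic q i) = generate_ring (hecke q) (parabolic_generators q i)"
  by (simp add: hecke_parabolic_def parabolic_generators_def)

lemma parabolic_ops [simp]:
  "add (hecke_parabolic q i) = add (hecke q)"
  "monoid.mult (hecke_parabolic q i) = monoid.mult (hecke q)"
  "one (hecke_parabolic q i) = one (hecke q)"
  "ring.zero (hecke_parabolic q i) = ring.zero (hecke q)"
  by (simp_all add: hecke_parabolic_def)

lemma ring_parabolic: "ring (hecke_parabolic q i)"
  unfolding hecke_parabolic_def
  by (rule ring.generate_ring_is_ring [OF ring_hecke])
    (use parabolic_generators_subset in \<open>simp add: parabolic_generators_def\<close>)

lemma parabolic_subset: "carrier (hecke_parabolic q i) \<subseteq> carrier (hecke q)"
  unfolding carrier_parabolic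
  by (rule ring.generate_ring_incl [OF ring_hecke parabolic_generators_subset])

lemma genT_in_parabolic: "hecke_of q (genT i) \<in> carrier (hecke_parabolic q i)"
  unfolding carrier_parabolic by (rule generate_ring.incl) (simp add: parabolic_generators_def)

lemma lift_in_parabolic: "hecke_of q (lift_group_alg f) \<in> carrier (hecke_parabolic q i)"
  unfolding carrier_parabolic by (rule generate_ring.incl) (simp add: parabolic_generators_def)

lemma genX_in_parabolic: "hecke_of q (genX l) \<in> carrier (hecke_parabolic q i)"
  using lift_in_parabolic [of q "Poly_Mapping.single l 1"] by (simp add: lift_group_alg_single)

lemma scal_in_parabolic: "hecke_of q (scal c) \<in> carrier (hecke_parabolic q i)"
proof -
  interpret H: ring "hecke q" by (rule ring_hecke)
  have "hecke_of q (lift_group_alg (Poly_Mapping.single 0 c)) = hecke_of q (scal c)"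
    by (simp add: lift_group_alg_single hecke_of_mult hecke_of_genX_0 hecke_of_closed)
  then show ?thesis using lift_in_parabolic by metis
qed

section \<open>The character of the parabolic subalgebra\<close>

context cubic_parameter
begin

lemma hecke_ideal_act:
  assumes "x \<in> Idl\<^bsub>free_algebra\<^esub> (hecke_rels q)"
  shows "words.algebra_act q x v = 0"
proof -
  interpret ring free_algebra by (rule ring_free_algebra)
  let ?A = "{x. \<forall>v. words.algebra_act q x v = 0}"
  have "additive_subgroup ?A free_algebra"
  proof (intro additive_subgroup.intro subgroup.intro)
    fix x assume "x \<in> ?A"
    moreover have "inv\<^bsub>add_monoid free_algebra\<^esub> x = - x"
      using minus_equality [of "- x" x] by (simp add: a_inv_def)
    ultimately show "inv\<^bsub>add_monoid free_algebra\<^esub> x \<in> ?A"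
      by (simp add: words.algebra_act_minus)
  qed (auto simp: words.algebra_act_plus)
  then have "ideal ?A free_algebra"
    by (intro idealI [OF ring_free_algebra] additive_subgroup.a_subgroup)
      (simp_all add: words.algebra_act_times del: split_paired_All)
  then have "Idl\<^bsub>free_algebra\<^esub> (hecke_rels q) \<subseteq> ?A"
    by (rule genideal_minimal) (simp add: hecke_rels_act subset_iff)
  then show ?thesis using assms by blast
qed

text \<open>An element of the Hecke algebra is a coset, and any representative acts in the same way.\<close>

definition hecke_act :: "free_alg set \<Rightarrow> vec6 \<Rightarrow> vec6" where
  "hecke_act C = words.algebra_act q (SOME x. C = hecke_of q x)"

lemma hecke_act_hecke_of [simp]: "hecke_act (hecke_of q x) v = words.algebra_act q x v"
proof -
  let ?y = "SOME y. hecke_of q x = hecke_of q y"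
  have "hecke_of q x = hecke_of q ?y" by (rule someI) (rule refl)
  then have "words.algebra_act q (x - ?y) v = 0" by (intro hecke_ideal_act hecke_of_eqD)
  then show ?thesis by (simp add: hecke_act_def words.algebra_act_diff)
qed

text \<open>The generators of the parabolic subalgebra preserve the line of e0, hence so does the
  subalgebra.\<close>

lemma parabolic_act_e0:
  assumes "C \<in> carrier (hecke_parabolic q N1)"
  shows "hecke_act C e0 = scale6 (fst (hecke_act C e0)) e0"
proof -
  have scalar: "v = scale6 (fst v) e0" if "v = scale6 z e0" for v z
    using that by (simp add: e0_def)
  have "\<exists>x z. C = hecke_of q x \<and> words.algebra_act q x e0 = scale6 z e0"
    using assms unfolding carrier_parabolic
  proof induction
    case one
    have "words.algebra_act q 1 e0 = scale6 1 e0" by simp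
    then show ?case using hecke_of_1 by metis
  next
    case (incl C)
    have lift: "\<exists>z. words.algebra_act q (lift_group_alg f) e0 = scale6 z e0" for f
    proof (induction f rule: poly_mapping_single_induct)
      case zero
      have "words.algebra_act q (lift_group_alg 0) e0 = scale6 0 e0" by (simp add: lift_group_alg_def)
      then show ?case ..
    next
      case (single_add l c f)
      then obtain z where "words.algebra_act q (lift_group_alg f) e0 = scale6 z e0" ..
      then have "words.algebra_act q (lift_group_alg (Poly_Mapping.single l c + f)) e0 =
          scale6 (c * torus_point (q^2) 1 l + z) e0"
        by (simp add: lift_group_alg_add lift_group_alg_single words.algebra_act_plus
            words.algebra_act_times single_act weight_op_e0 scale6.scale_left_distrib)
      then show ?case ..
    qed
    have "words.algebra_act q (genT N1) e0 = scale6 q e0" by (simp add: single_act T1_e0)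
    then show ?case using incl lift by (auto simp: parabolic_generators_def)
  next
    case (a_inv C)
    then obtain x z where *: "C = hecke_of q x" "words.algebra_act q x e0 = scale6 z e0" by blast
    then have "words.algebra_act q (- x) e0 = scale6 (- z) e0"
      by (simp add: words.algebra_act_minus)
    then show ?case using *(1) hecke_of_uminus by metis
  next
    case (eng_add C D)
    then obtain x y z w where *: "C = hecke_of q x" "words.algebra_act q x e0 = scale6 z e0"
      "D = hecke_of q y" "words.algebra_act q y e0 = scale6 w e0" by blast
    then have "words.algebra_act q (x + y) e0 = scale6 (z + w) e0"
      by (simp add: words.algebra_act_plus scale6.scale_left_distrib)
    then show ?case using *(1,3) hecke_of_add by metis
  next
    case (eng_mult C D)
    then obtain x y z w where *: "C = hecke_of q x" "words.algebra_act q x e0 = scale6 z e0"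
      "D = hecke_of q y" "words.algebra_act q y e0 = scale6 w e0" by blast
    then have "words.algebra_act q (x * y) e0 = scale6 (w * z) e0"
      by (simp add: words.algebra_act_times words.algebra_act_scale)
    then show ?case using *(1,3) hecke_of_mult by metis
  qed
  then obtain x z where "C = hecke_of q x" "words.algebra_act q x e0 = scale6 z e0" by blast
  then show ?thesis by (intro scalar [of _ z]) simp
qed

text \<open>The subalgebra may satisfy relations that are consequences of those of the whole
  algebra, so its character is obtained from a module of the whole algebra: by the
  action on the line of e0.\<close>

lemma one_dim_module_exists: "\<exists>V. one_dim_module q N1 q (torus_point (q^2) 1) V"
proof -
  define \<chi> where "\<chi> C = fst (hecke_act C e0)" for C
  define V :: "(free_alg set, complex) module" where
    "V = \<lparr>carrier = UNIV, monoid.mult = (*), one = 1, ring.zero = 0, add = (+),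
          smult = (\<lambda>C z. \<chi> C * z)\<rparr>"
  let ?S = "hecke_parabolic q N1"
  have rep: "\<exists>x. C = hecke_of q x" if "C \<in> carrier ?S" for C
    using that parabolic_subset hecke_of_surj by blast
  have \<chi>_e0: "\<chi> (hecke_of q x) = z" if "words.algebra_act q x e0 = scale6 z e0" for x z
    using that by (simp add: \<chi>_def e0_def)
  have "left_module ?S V"
  proof (intro left_module.intro left_module_axioms.intro ring_parabolic)
    have "\<exists>w. w + z = 0" for z :: complex by (rule exI [of _ "- z"]) simp
    then show "abelian_group V" by (intro abelian_groupI) (auto simp: V_def)
  next
    fix C D z assume *: "C \<in> carrier ?S" "D \<in> carrier ?S"
    then obtain x y where xy: "C = hecke_of q x" "D = hecke_of q y" using rep by metis
    show "(C \<oplus>\<^bsub>?S\<^esub> D) \<odot>\<^bsub>V\<^esub> z = C \<odot>\<^bsub>V\<^esub> z \<oplus>\<^bsub>V\<^esub> D \<odot>\<^bsub>V\<^esub> z"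
      by (simp add: V_def xy \<chi>_def words.algebra_act_plus distrib_right flip: hecke_of_add)
    have e: "words.algebra_act q x e0 = scale6 (\<chi> C) e0" "words.algebra_act q y e0 = scale6 (\<chi> D) e0"
      using parabolic_act_e0 [OF *(1)] parabolic_act_e0 [OF *(2)] by (simp_all add: xy \<chi>_def)
    have "\<chi> (hecke_of q (x * y)) = \<chi> C * \<chi> D"
      by (rule \<chi>_e0) (simp add: words.algebra_act_times words.algebra_act_scale e mult.commute)
    then show "(C \<otimes>\<^bsub>?S\<^esub> D) \<odot>\<^bsub>V\<^esub> z = C \<odot>\<^bsub>V\<^esub> (D \<odot>\<^bsub>V\<^esub> z)"
      by (simp add: V_def xy hecke_of_mult)
  next
    have "\<chi> (hecke_of q 1) = 1" by (rule \<chi>_e0) simp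
    then show "\<one>\<^bsub>?S\<^esub> \<odot>\<^bsub>V\<^esub> z = z" for z by (simp add: V_def hecke_of_1)
  qed (simp_all add: V_def distrib_left)
  moreover have "\<chi> (hecke_of q (scal a)) = a" for a
    by (rule \<chi>_e0) (simp add: single_act)
  moreover have "\<chi> (hecke_of q (genT N1)) = q"
    by (rule \<chi>_e0) (simp add: single_act T1_e0)
  moreover have "\<chi> (hecke_of q (genX l)) = torus_point (q^2) 1 l" for l
    by (rule \<chi>_e0) (simp add: single_act weight_op_e0)
  ultimately have "one_dim_module q N1 q (torus_point (q^2) 1) V"
    unfolding one_dim_module_def by (simp add: V_def)
  then show ?thesis ..
qed

end

section \<open>The induced module is the six-dimensional representation\<close>

locale one_dim_induction = cubic_parameter q for q :: complex +
  fixes V :: "(free_alg set, complex) module"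
  assumes one_dim: "one_dim_module q N1 q (torus_point (q^2) 1) V"
begin

abbreviation H :: "free_alg set ring" where "H \<equiv> hecke q"
abbreviation S :: "free_alg set ring" where "S \<equiv> hecke_parabolic q N1"

sublocale V: left_module S V
  using one_dim by (simp add: one_dim_module_def)

lemma V_simps [simp]: "carrier V = UNIV" "\<zero>\<^bsub>V\<^esub> = 0" "v \<oplus>\<^bsub>V\<^esub> w = v + w"
  using one_dim by (simp_all add: one_dim_module_def)

lemma V_scal: "hecke_of q (scal a) \<odot>\<^bsub>V\<^esub> z = a * z"
  and V_T1: "hecke_of q (genT N1) \<odot>\<^bsub>V\<^esub> 1 = q"
  and V_X: "hecke_of q (genX l) \<odot>\<^bsub>V\<^esub> 1 = torus_point (q^2) 1 l"
  using one_dim by (simp_all add: one_dim_module_def del: split_paired_All)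

sublocale tensor_data H S V
  by (intro tensor_data.intro tensor_data_axioms.intro ring_hecke parabolic_subset) simp_all

text \<open>The module axioms only speak of additive maps; complex linearity follows because the scalars
  are central in the algebra and act on V as scalars.\<close>

lemma V_mult_1:
  assumes "hecke_of q x \<in> carrier S"
  shows "hecke_of q x \<odot>\<^bsub>V\<^esub> z = z * (hecke_of q x \<odot>\<^bsub>V\<^esub> 1)"
proof -
  have "hecke_of q x \<odot>\<^bsub>V\<^esub> z = hecke_of q x \<odot>\<^bsub>V\<^esub> (hecke_of q (scal z) \<odot>\<^bsub>V\<^esub> 1)"
    by (simp add: V_scal)
  also have "\<dots> = hecke_of q (x * scal z) \<odot>\<^bsub>V\<^esub> 1"
    using V.lsmult_assoc [OF assms scal_in_parabolic, of 1 z] by (simp add: hecke_of_mult)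
  also have "\<dots> = hecke_of q (scal z) \<odot>\<^bsub>V\<^esub> (hecke_of q x \<odot>\<^bsub>V\<^esub> 1)"
    using V.lsmult_assoc [OF scal_in_parabolic assms, of 1 z]
    by (simp add: hecke_of_mult scal_commute)
  finally show ?thesis by (simp add: V_scal)
qed

lemma V_T1_scaled: "hecke_of q (genT N1) \<odot>\<^bsub>V\<^esub> z = z * q"
  by (subst V_mult_1 [OF genT_in_parabolic]) (simp only: V_T1)

lemma V_X_scaled: "hecke_of q (genX l) \<odot>\<^bsub>V\<^esub> z = z * torus_point (q^2) 1 l"
  by (subst V_mult_1 [OF genX_in_parabolic]) (simp only: V_X)

lemma V_lift:
  "scale6 (hecke_of q (lift_group_alg f) \<odot>\<^bsub>V\<^esub> z) e0
   = words.algebra_act q (lift_group_alg f) (scale6 z e0)"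
proof (induction f rule: poly_mapping_single_induct)
  case zero
  have "hecke_of q (scal 0) \<odot>\<^bsub>V\<^esub> z = 0" by (simp only: V_scal mult_zero_left)
  then show ?case by (simp add: lift_group_alg_def)
next
  case (single_add l c f)
  have "hecke_of q (scal c * genX l) \<odot>\<^bsub>V\<^esub> z = c * (z * torus_point (q^2) 1 l)"
    using V.lsmult_assoc [OF scal_in_parabolic genX_in_parabolic, of z c l]
    by (simp add: hecke_of_mult V_scal V_X_scaled)
  moreover have "hecke_of q (lift_group_alg (Poly_Mapping.single l c + f)) \<odot>\<^bsub>V\<^esub> z =
      hecke_of q (scal c * genX l) \<odot>\<^bsub>V\<^esub> z + hecke_of q (lift_group_alg f) \<odot>\<^bsub>V\<^esub> z"
  proof -
    have "hecke_of q (scal c * genX l) \<in> carrier S"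
      using lift_in_parabolic [of q "Poly_Mapping.single l c" N1]
      by (simp only: lift_group_alg_single)
    from V.lsmult_l_distr [OF this lift_in_parabolic, of z f] show ?thesis
      by (simp add: lift_group_alg_add lift_group_alg_single hecke_of_add)
  qed
  ultimately show ?case
    using single_add
    by (simp add: lift_group_alg_add lift_group_alg_single words.algebra_act_plus
        words.algebra_act_times words.algebra_act_scale single_act weight_op_e0
        scale6.scale_left_distrib scale6.scale_right_distrib mult.commute mult.left_commute)
qed

text \<open>The given module V and the line of e0 carry the same action of the generators of the parabolic
  subalgebra, hence of the whole subalgebra, whichever module structure V was given.\<close>

lemma parabolic_act_V:
  assumes "C \<in> carrier S"
  shows "hecke_act C (scale6 z e0) = scale6 (C \<odot>\<^bsub>V\<^esub> z) e0"
proof -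
  have "\<exists>x. C = hecke_of q x \<and>
      (\<forall>z. words.algebra_act q x (scale6 z e0) = scale6 (C \<odot>\<^bsub>V\<^esub> z) e0)"
    using assms unfolding carrier_parabolic
  proof induction
    case one
    have "\<one>\<^bsub>H\<^esub> \<odot>\<^bsub>V\<^esub> z = z" for z using V.lsmult_one [of z] by simp
    then show ?case by (intro exI [of _ 1]) (simp add: hecke_of_1)
  next
    case (incl C)
    then consider "C = hecke_of q (genT N1)" | f where "C = hecke_of q (lift_group_alg f)"
      by (auto simp: parabolic_generators_def)
    then show ?case
    proof cases
      case 1
      then show ?thesis
        by (intro exI [of _ "genT N1"]) (simp add: single_act V_T1_scaled T_op_linear T1_e0)
    next
      case (2 f)
      then show ?thesis
        by (intro exI [of _ "lift_group_alg f"]) (simp add: V_lift)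
    qed
  next
    case (a_inv C)
    then obtain x where x: "C = hecke_of q x"
      "\<And>z. words.algebra_act q x (scale6 z e0) = scale6 (C \<odot>\<^bsub>V\<^esub> z) e0" by blast
    have C: "hecke_of q x \<in> carrier S" using a_inv.hyps by (simp add: carrier_parabolic x)
    have "hecke_of q (scal (- 1) * x) \<odot>\<^bsub>V\<^esub> z = - (C \<odot>\<^bsub>V\<^esub> z)" for z
      using V.lsmult_assoc [OF scal_in_parabolic C, of z "- 1"]
      by (simp add: V_scal x hecke_of_mult)
    moreover have "scal (- 1) * x = - x" by (simp add: scal_uminus)
    ultimately have "hecke_of q (- x) \<odot>\<^bsub>V\<^esub> z = - (C \<odot>\<^bsub>V\<^esub> z)" for z by simp
    then show ?case
      by (intro exI [of _ "- x"]) (simp add: hecke_of_uminus x words.algebra_act_minus)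
  next
    case (eng_add C D)
    then obtain x y where x: "C = hecke_of q x"
      "\<And>z. words.algebra_act q x (scale6 z e0) = scale6 (C \<odot>\<^bsub>V\<^esub> z) e0"
      and y: "D = hecke_of q y"
      "\<And>z. words.algebra_act q y (scale6 z e0) = scale6 (D \<odot>\<^bsub>V\<^esub> z) e0" by blast
    have "(C \<oplus>\<^bsub>H\<^esub> D) \<odot>\<^bsub>V\<^esub> z = C \<odot>\<^bsub>V\<^esub> z + D \<odot>\<^bsub>V\<^esub> z" for z
      using V.lsmult_l_distr [of C D z] eng_add.hyps by (simp add: carrier_parabolic)
    then show ?case
      by (intro exI [of _ "x + y"])
        (simp add: x y hecke_of_add words.algebra_act_plus scale6.scale_left_distrib)
  next
    case (eng_mult C D)
    then obtain x y where x: "C = hecke_of q x"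
      "\<And>z. words.algebra_act q x (scale6 z e0) = scale6 (C \<odot>\<^bsub>V\<^esub> z) e0"
      and y: "D = hecke_of q y"
      "\<And>z. words.algebra_act q y (scale6 z e0) = scale6 (D \<odot>\<^bsub>V\<^esub> z) e0" by blast
    have "(C \<otimes>\<^bsub>H\<^esub> D) \<odot>\<^bsub>V\<^esub> z = C \<odot>\<^bsub>V\<^esub> (D \<odot>\<^bsub>V\<^esub> z)" for z
      using V.lsmult_assoc [of C D z] eng_mult.hyps by (simp add: carrier_parabolic)
    then show ?case
      by (intro exI [of _ "x * y"]) (simp add: x y hecke_of_mult words.algebra_act_times)
  qed
  then show ?thesis by force
qed

text \<open>The element x (1 \<otimes> 1) of the induced module. Since the scalars of V come from the algebra,
  all elements have this form.\<close>

definition induced_generator_mult :: "free_alg \<Rightarrow> (free_alg set \<times> complex \<Rightarrow>\<^sub>0 int) set" where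
  "induced_generator_mult x = cls (frag_of (hecke_of q x, 1))"

abbreviation "m \<equiv> induced_generator_mult"

lemma frag_of_hecke_in_F: "frag_of (hecke_of q x, v) \<in> carrier F"
  by (rule frag_of_F) (simp_all add: hecke_of_closed)

lemma cls_balanced:
  assumes "hecke_of q s \<in> carrier S"
  shows "cls (frag_of (hecke_of q (x * s), v)) = cls (frag_of (hecke_of q x, hecke_of q s \<odot>\<^bsub>V\<^esub> v))"
  using tensor_rels_balanced [of "hecke_of q x" "hecke_of q s" v] assms
  by (simp add: cls_eq_iff generate.incl hecke_of_closed hecke_of_mult)

lemma m_closed: "m x \<in> carrier Ind"
  unfolding induced_generator_mult_def by (rule cls_in_carrier) (rule frag_of_hecke_in_F)

lemma m_add: "m (x + y) = m x \<oplus>\<^bsub>Ind\<^esub> m y"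
  using tensor_rels_add_left [of "hecke_of q x" "hecke_of q y" 1]
  by (simp add: induced_generator_mult_def add_Ind cls_eq_iff generate.incl hecke_of_closed hecke_of_add)

lemma m_mult: "hecke_of q y \<odot>\<^bsub>Ind\<^esub> m x = m (y * x)"
  by (simp add: induced_generator_mult_def smult_Ind hecke_of_closed hecke_of_mult)

sublocale Ind: left_module H Ind
  by (rule left_module_Ind)

lemma m_0: "m 0 = \<zero>\<^bsub>Ind\<^esub>"
  using m_add [of 0 0] m_closed [of 0] Ind.M.add.l_cancel_one' by auto

lemma m_diff: "m (x - y) = \<zero>\<^bsub>Ind\<^esub> \<longleftrightarrow> m x = m y"
proof -
  have "m x = m (x - y) \<oplus>\<^bsub>Ind\<^esub> m y" by (simp flip: m_add)
  then show ?thesis by (simp add: m_closed)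
qed

text \<open>Elements of the parabolic subalgebra can be moved across the tensor sign: s \<otimes> 1 and z \<otimes> 1 are both
  equal to 1 \<otimes> z.\<close>

lemma m_scalar:
  assumes "hecke_of q s \<in> carrier S" "hecke_of q s \<odot>\<^bsub>V\<^esub> 1 = z" shows "m s = m (scal z)"
  using cls_balanced [OF assms(1), of 1 1] cls_balanced [OF scal_in_parabolic, of 1 z 1] assms(2)
  by (simp add: induced_generator_mult_def V_scal)

lemma carrier_Ind_m: "C \<in> carrier Ind \<Longrightarrow> \<exists>x. C = m x"
proof -
  assume "C \<in> carrier Ind"
  then obtain u where u: "u \<in> carrier F" "C = cls u" by (auto simp: carrier_Ind)
  have "\<exists>x. cls u = m x" using u(1)
  proof (induction rule: F_induct)
    case zero
    have "cls 0 = m 0" by (simp only: m_0 zero_Ind)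
    then show ?case ..
  next
    case (diff u w)
    then obtain x y where xy: "cls u = m x" "cls w = m y" by blast
    have "cls (u - w) \<oplus>\<^bsub>Ind\<^esub> cls w = cls u" by (simp only: add_Ind diff_add_cancel)
    moreover have "m (x - y) \<oplus>\<^bsub>Ind\<^esub> m y = m x" by (simp only: diff_add_cancel flip: m_add)
    ultimately have "cls (u - w) \<oplus>\<^bsub>Ind\<^esub> m y = m (x - y) \<oplus>\<^bsub>Ind\<^esub> m y"
      by (simp only: xy)
    then have "cls (u - w) = m (x - y)"
      by (rule Ind.M.add.right_cancel [THEN iffD1, rotated -1])
        (intro m_closed cls_in_carrier F_diff diff)+
    then show ?case ..
  next
    case (frag_of a v)
    obtain x where x: "a = hecke_of q x" using frag_of(1) by (rule hecke_of_surj)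
    have "cls (frag_of (a, v)) = m (x * scal v)"
      using cls_balanced [OF scal_in_parabolic, of x v 1]
      by (simp add: x induced_generator_mult_def V_scal)
    then show ?case ..
  qed
  then show ?thesis using u(2) by simp
qed

definition annihilator :: "free_alg set" where "annihilator = {x. m x = \<zero>\<^bsub>Ind\<^esub>}"

lemma hecke_smult_zero: "hecke_of q y \<odot>\<^bsub>Ind\<^esub> \<zero>\<^bsub>Ind\<^esub> = \<zero>\<^bsub>Ind\<^esub>"
  using m_mult [of y 0] by (simp add: m_0)

sublocale J: character_left_ideal q "torus_point (q^2) 1" annihilator
proof
  fix x y assume "x \<in> annihilator" "y \<in> annihilator"
  then show "x + y \<in> annihilator" by (simp add: annihilator_def m_add)
next
  fix x y assume "x \<in> annihilator"
  then show "y * x \<in> annihilator"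
    by (simp add: annihilator_def hecke_smult_zero flip: m_mult)
next
  fix r y assume "r \<in> hecke_rels q"
  then have "hecke_of q (r * y) = hecke_of q 0"
    by (simp add: hecke_of_mult hecke_of_rel hecke_of_0 hecke_of_closed)
  then have "m (r * y) = m 0" by (simp add: induced_generator_mult_def)
  then show "r * y \<in> annihilator" by (simp add: annihilator_def m_0)
next
  show "genT N1 - scal q \<in> annihilator"
    using m_scalar [OF genT_in_parabolic V_T1] by (simp add: annihilator_def m_diff)
next
  show "genX l - scal (torus_point (q^2) 1 l) \<in> annihilator" for l
    using m_scalar [OF genX_in_parabolic V_X] by (simp add: annihilator_def m_diff)
qed

text \<open>The map from the tensor product to the six-dimensional representation given by the
  universal property, a \<otimes> z being sent to a (z e0).\<close>

definition tensor_eval :: "(free_alg set \<times> complex \<Rightarrow>\<^sub>0 int) \<Rightarrow> vec6" where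
  "tensor_eval = linear_extension (\<lambda>n v. scale6 (of_int n) v) (\<lambda>(C, z). hecke_act C (scale6 z e0))"

lemma tensor_eval_add: "tensor_eval (x + y) = tensor_eval x + tensor_eval y"
  unfolding tensor_eval_def by (rule linear_extension_add) (simp_all add: scale6.scale_left_distrib)

lemma tensor_eval_diff: "tensor_eval (x - y) = tensor_eval x - tensor_eval y"
  using tensor_eval_add [of "x - y" y] by simp

lemma tensor_eval_frag_of: "tensor_eval (frag_of (C, z)) = hecke_act C (scale6 z e0)"
  by (simp add: tensor_eval_def linear_extension_single)

lemma tensor_eval_relations:
  assumes "u \<in> relations" shows "tensor_eval u = 0"
  using assms
proof (induction rule: relations_induct)
  case zero
  then show ?case using tensor_eval_diff [of 0 0] by simp
next
  case (rel u)
  then show ?case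
  proof (cases rule: tensor_rels_cases)
    case (add_left a b v)
    obtain x where "a = hecke_of q x" using add_left(1) by (rule hecke_of_surj)
    moreover obtain y where "b = hecke_of q y" using add_left(2) by (rule hecke_of_surj)
    ultimately show ?thesis
      by (simp add: add_left tensor_eval_diff tensor_eval_add tensor_eval_frag_of
          words.algebra_act_plus flip: hecke_of_add)
  next
    case (add_right a v w)
    obtain x where "a = hecke_of q x" using add_right(1) by (rule hecke_of_surj)
    then show ?thesis
      by (simp add: add_right tensor_eval_diff tensor_eval_add tensor_eval_frag_of
          words.algebra_act_add scale6.scale_left_distrib)
  next
    case (balanced a s v)
    obtain x where x: "a = hecke_of q x" using balanced(1) by (rule hecke_of_surj)
    obtain y where y: "s = hecke_of q y"
      using S_subset [THEN subsetD, OF balanced(2)] by (rule hecke_of_surj)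
    have "words.algebra_act q y (scale6 v e0) = scale6 (s \<odot>\<^bsub>V\<^esub> v) e0"
      using parabolic_act_V [OF balanced(2)] by (simp add: y)
    then show ?thesis
      by (simp add: balanced x y tensor_eval_diff tensor_eval_frag_of
          words.algebra_act_times flip: hecke_of_mult)
  qed
next
  case (diff u w)
  then show ?case by (simp add: tensor_eval_diff)
qed

lemma annihilator_iff: "x \<in> annihilator \<longleftrightarrow> words.algebra_act q x e0 = 0"
proof (rule J.eq_annihilator)
  fix x assume "x \<in> annihilator"
  then have "frag_of (hecke_of q x, 1) - 0 \<in> relations"
    by (simp only: annihilator_def mem_Collect_eq induced_generator_mult_def zero_Ind cls_eq_iff)
  then show "words.algebra_act q x e0 = 0"
    using tensor_eval_relations [of "frag_of (hecke_of q x, 1)"] by (simp add: tensor_eval_frag_of)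
qed

text \<open>If x (1 \<otimes> 1) is a nonzero element of a submodule, then x e0 is nonzero and some h satisfies
  h x e0 = e0. As the annihilators agree, h x (1 \<otimes> 1) = 1 \<otimes> 1, which generates everything.\<close>

lemma irreducible_Ind: "irreducible_module H Ind"
proof (intro irreducible_module.intro left_module_Ind irreducible_module_axioms.intro)
  have "1 \<notin> annihilator" by (simp add: annihilator_iff e0_def zero_prod_def)
  then show "carrier Ind \<noteq> {\<zero>\<^bsub>Ind\<^esub>}"
    using m_closed [of 1] by (auto simp: annihilator_def)
next
  fix N assume N: "submodule N H Ind"
  then interpret N: submodule N H Ind .
  have "carrier Ind \<subseteq> N" if "N \<noteq> {\<zero>\<^bsub>Ind\<^esub>}"
  proof
    have "\<zero>\<^bsub>Ind\<^esub> \<in> N" using N.one_closed by simp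
    then have "\<not> N \<subseteq> {\<zero>\<^bsub>Ind\<^esub>}" using that by (metis subset_singletonD empty_iff)
    then obtain C where "C \<in> N" "C \<notin> {\<zero>\<^bsub>Ind\<^esub>}" by (meson subsetI)
    then have C: "C \<in> N" "C \<noteq> \<zero>\<^bsub>Ind\<^esub>" by simp_all
    then have "C \<in> carrier Ind" using N.subset by auto
    from carrier_Ind_m [OF this] obtain x where x: "C = m x" ..
    then have "words.algebra_act q x e0 \<noteq> 0" using C(2) annihilator_iff by (auto simp: annihilator_def)
    from generates_e0 [OF this]
    obtain h where "words.algebra_act q h (words.algebra_act q x e0) = e0" ..
    then have "h * x - 1 \<in> annihilator"
      by (simp add: annihilator_iff words.algebra_act_diff words.algebra_act_times)
    then have "m 1 = hecke_of q h \<odot>\<^bsub>Ind\<^esub> C"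
      by (simp add: annihilator_def m_diff m_mult x)
    then have one: "m 1 \<in> N" using C(1) by (simp add: N.smult_closed hecke_of_closed)
    fix D assume "D \<in> carrier Ind"
    from carrier_Ind_m [OF this] obtain y where "D = m y" ..
    then have "D = hecke_of q y \<odot>\<^bsub>Ind\<^esub> m 1" by (simp add: m_mult)
    then show "D \<in> N" using one by (simp add: N.smult_closed hecke_of_closed)
  qed
  then show "N = {\<zero>\<^bsub>Ind\<^esub>} \<or> N = carrier Ind" using N.subset by auto
qed

end

section \<open>Both modules\<close>

text \<open>The parameter enters the relations only through q - 1/q. This allows q to be exchanged
  with -1/q.\<close>

lemma hecke_rels_eq:
  assumes "p - inverse p = q - inverse q" shows "hecke_rels p = hecke_rels q"
proof -
  have "hecke_rels p \<subseteq> hecke_rels q" if eq: "p - inverse p = q - inverse q" for p q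
  proof
    fix x assume "x \<in> hecke_rels p"
    then show "x \<in> hecke_rels q"
    proof cases
      case quadratic
      then show ?thesis unfolding eq by (simp only: hecke_rels.quadratic)
    next
      case bernstein
      then show ?thesis unfolding eq by (simp only: hecke_rels.bernstein)
    qed (simp_all only: hecke_rels.X_zero hecke_rels.X_add hecke_rels.braid)
  qed
  from this [OF assms] this [OF assms [symmetric]] show ?thesis by (rule equalityI)
qed

lemma one_dim_module_eq:
  assumes "hecke_rels p = hecke_rels q"
  shows "hecke p = hecke q" "hecke_parabolic p i = hecke_parabolic q i"
    "one_dim_module p i c t = one_dim_module q i c t"
proof -
  have "hecke_of p = hecke_of q" by (intro ext) (simp add: hecke_of_def assms)
  then show "hecke p = hecke q" "hecke_parabolic p i = hecke_parabolic q i"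
    "one_dim_module p i c t = one_dim_module q i c t"
    by (auto simp: hecke_def hecke_parabolic_def one_dim_module_def assms intro!: ext)
qed

lemma weyl_w0_eq: "weyl_w0 l = - l"
  by (cases l) (simp add: weyl_w0_def simple_refl_def)

lemma weyl_act_w0: "weyl_act weyl_w0 (torus_point z w) = torus_point (inverse z) (inverse w)"
proof
  fix l
  have "inv_into UNIV weyl_w0 l = - l"
    by (rule inv_f_eq) (auto simp: weyl_w0_eq inj_def)
  then show "weyl_act weyl_w0 (torus_point z w) l = torus_point (inverse z) (inverse w) l"
    by (simp add: weyl_act_def torus_point_def power_int_minus power_int_inverse)
qed

lemma primitive_cube_root:
  assumes "primitive_root_of_unity 3 (q^2)" shows "cubic_parameter q"
proof
  have "(q^2) ^ 3 = 1" "(q^2) ^ 1 \<noteq> 1"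
    using assms unfolding primitive_root_of_unity_def by fastforce+
  moreover have "(q^2 - 1) * (q ^ 4 + q ^ 2 + 1) = (q^2) ^ 3 - 1"
    by (simp add: eval_nat_numeral algebra_simps)
  ultimately show "q ^ 4 + q ^ 2 + 1 = 0" by auto
qed

theorem proposition28:
  fixes q :: complex
  assumes "q \<noteq> 0"
    and "primitive_root_of_unity 3 (q^2)"
  shows "(\<exists>V. one_dim_module q N1 q (torus_point (q^2) 1) V) \<and>
         (\<forall>V. one_dim_module q N1 q (torus_point (q^2) 1) V \<longrightarrow>
              irreducible_module (hecke q) (induced_module (hecke q) (hecke_parabolic q N1) V)) \<and>
         (\<exists>V. one_dim_module q N1 (- inverse q) (weyl_act weyl_w0 (torus_point (q^2) 1)) V) \<and>
         (\<forall>V. one_dim_module q N1 (- inverse q) (weyl_act weyl_w0 (torus_point (q^2) 1)) V \<longrightarrow>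
              irreducible_module (hecke q) (induced_module (hecke q) (hecke_parabolic q N1) V))"
proof -
  have q: "cubic_parameter q" using assms(2) by (rule primitive_cube_root)
  define p where "p = - inverse q"
  have p: "cubic_parameter p"
  proof
    have "p ^ 4 + p ^ 2 + 1 = (q ^ 4 + q ^ 2 + 1) / q ^ 4"
      using assms(1) by (simp add: p_def field_simps eval_nat_numeral)
    then show "p ^ 4 + p ^ 2 + 1 = 0" using cubic_parameter.root [OF q] by simp
  qed
  have t: "weyl_act weyl_w0 (torus_point (q^2) 1) = torus_point (p^2) 1"
    by (simp add: weyl_act_w0 p_def power_inverse)
  have "p - inverse p = q - inverse q" by (simp add: p_def)
  note eq = one_dim_module_eq [OF hecke_rels_eq [OF this]]
  have main: "\<exists>V. one_dim_module r N1 r (torus_point (r^2) 1) V"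
    "\<forall>V. one_dim_module r N1 r (torus_point (r^2) 1) V \<longrightarrow>
       irreducible_module (hecke r) (induced_module (hecke r) (hecke_parabolic r N1) V)"
    if r: "cubic_parameter r" for r
    using cubic_parameter.one_dim_module_exists [OF r] one_dim_induction.irreducible_Ind
      one_dim_induction.intro [OF r] one_dim_induction_axioms.intro
    by blast+
  show ?thesis
    using main [OF q] main [OF p] by (simp only: eq t flip: p_def)
qed

end
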